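(* Let $A$ be a Young function with complementary function $\widetilde A$. Assume that $$\int_0^\infty\widetilde A(t_0\tau)e^{-\tau}\,d\tau<\infty\quad\text{for some }t_0>0,\qquad(\ast)$$ and let $B_A$ be the Young function whose complementary function satisfies $$\widetilde{B_A}(t)=\int_0^\infty\widetilde A(t\tau)e^{-\tau}\,d\tau\quad\text{for }t\in[0,\infty].$$ Let $M$ be the Hardy–Littlewood maximal operator on $\mathbb R^n$. Then the following statements are equivalent. (i) $M\colon L^A(\mathbb R^n)\to L^{B_A}(\mathbb R^n)$; (ii) the space $L^{B_A}(\mathbb R^n)$ is the smallest Orlicz space $L^B(\mathbb R^n)$ such that $M\colon L^A(\mathbb R^n)\to L^B(\mathbb R^n)$; (iii) there exists a smallest Orlicz space $L^B(\mathbb R^n)$ such that $M\colon L^A(\mathbb R^n)\to L^B(\mathbb R^n)$; (iv) there exists $K>0$ such that $$\int_0^t\frac{B_A(\tau)}{\tau^2}\,d\tau\le\frac{A(Kt)}{t}\quad\text{for all }t\in(0,\infty).$$ Conversely, if $A$ does not obey condition $(\ast)$, then there is no Orlicz space $L^B(\mathbb R^n)$ such that $M\colon L^A(\mathbb R^n)\to L^B(\mathbb R^n)$.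
   Context: A Young function is a convex, left-continuous $A:[0,\infty]\to[0,\infty]$ with $A(0)=0$, not identically zero or infinity on $(0,\infty]$. Its complementary function is the Young function $\widetilde A(t)=\sup\{\tau t-A(\tau):\tau>0\}$. The Orlicz space $L^A(\mathbb R^n)$ is the set of measurable $f$ with $\|f\|_{L^A}=\inf\{\lambda>0:\int_{\mathbb R^n}A(|f|/\lambda)\le1\}<\infty$. For locally integrable $f$ on $\mathbb R^n$, $Mf(x)=\sup_{Q\ni x}\frac1{|Q|}\int_Q|f(y)|\,dy$, the supremum being over all cubes $Q$ containing $x$ with sides parallel to the coordinate axes. $M\colon L^A\to L^B$ means that there is $C>0$ with $\|Mf\|_{L^B}\le C\|f\|_{L^A}$ for all $f\in L^A$. "Smallest" is with respect to inclusion: a smallest such Orlicz space has the property and is contained in every Orlicz space with the property. *)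

theory Defs
  imports "HOL-Analysis.Analysis"
begin

definition young_function :: "(ennreal \<Rightarrow> ennreal) \<Rightarrow> bool" where
  "young_function A \<longleftrightarrow>
     (\<forall>x y. \<forall>s\<in>{0..1::real}.
        A (ennreal s * x + ennreal (1 - s) * y) \<le> ennreal s * A x + ennreal (1 - s) * A y) \<and>
     (\<forall>t. (A \<longlongrightarrow> A t) (at_left t)) \<and>
     A 0 = 0 \<and>
     (\<exists>t>0. A t \<noteq> 0) \<and>
     (\<exists>t>0. A t \<noteq> \<infinity>)"

text \<open>Subtraction on \<^typ>\<open>ennreal\<close> is truncated at 0.  For a Young function this does not
  change the supremum, which is nonnegative anyway because \<open>A \<tau>\<close> tends to 0 as \<open>\<tau>\<close> tends to 0.
  The range excludes \<open>\<tau> = \<infinity>\<close>, where \<open>A \<tau> = \<infinity>\<close> and the difference is meaningless.\<close>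

definition complementary :: "(ennreal \<Rightarrow> ennreal) \<Rightarrow> ennreal \<Rightarrow> ennreal" where
  "complementary A t = (SUP \<tau>\<in>{0<..<\<infinity>}. \<tau> * t - A \<tau>)"

text \<open>The function \<open>t \<mapsto> \<integral>\<^sub>0\<^sup>\<infinity> A\<^sup>~(t \<tau>) exp (-\<tau>) d\<tau>\<close>, where \<open>A\<^sup>~\<close> is the complementary function.\<close>

definition exp_average_complementary :: "(ennreal \<Rightarrow> ennreal) \<Rightarrow> ennreal \<Rightarrow> ennreal" where
  "exp_average_complementary A t =
     (\<integral>\<^sup>+\<tau>\<in>{0<..}. complementary A (t * ennreal \<tau>) * ennreal (exp (- \<tau>)) \<partial>lborel)"

text \<open>The norm takes the modulus of the function as its argument, with values in
  \<open>[0, \<infinity>]\<close>, since maximal functions may be infinite at some points.\<close>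

definition luxemburg_norm :: "(ennreal \<Rightarrow> ennreal) \<Rightarrow> (real ^ 'n \<Rightarrow> ennreal) \<Rightarrow> ennreal" where
  "luxemburg_norm A g =
     (INF l\<in>{l::real. 0 < l \<and> (\<integral>\<^sup>+x. A (g x / ennreal l) \<partial>lebesgue) \<le> 1}. ennreal l)"

definition orlicz_space :: "(ennreal \<Rightarrow> ennreal) \<Rightarrow> (real ^ 'n \<Rightarrow> real) set" where
  "orlicz_space A =
     {f \<in> borel_measurable lebesgue. luxemburg_norm A (\<lambda>x. ennreal \<bar>f x\<bar>) < \<infinity>}"

definition is_cube :: "(real ^ 'n) set \<Rightarrow> bool" where
  "is_cube Q \<longleftrightarrow> (\<exists>a s. 0 < s \<and> Q = cbox a (a + (\<chi> i. s)))"

definition maximal_function :: "(real ^ 'n \<Rightarrow> real) \<Rightarrow> real ^ 'n \<Rightarrow> ennreal" where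
  "maximal_function f x =
     (SUP Q\<in>{Q. is_cube Q \<and> x \<in> Q}.
        (\<integral>\<^sup>+y\<in>Q. ennreal \<bar>f y\<bar> \<partial>lebesgue) / emeasure lebesgue Q)"

definition maximal_bounded ::
    "'n::finite itself \<Rightarrow> (ennreal \<Rightarrow> ennreal) \<Rightarrow> (ennreal \<Rightarrow> ennreal) \<Rightarrow> bool" where
  "maximal_bounded _ A B \<longleftrightarrow>
     (\<exists>C::real. 0 < C \<and>
       (\<forall>f \<in> (orlicz_space A :: (real ^ 'n \<Rightarrow> real) set).
          luxemburg_norm B (maximal_function f)
            \<le> ennreal C * luxemburg_norm A (\<lambda>x. ennreal \<bar>f x\<bar>)))"

definition smallest_orlicz_target ::
    "'n::finite itself \<Rightarrow> (ennreal \<Rightarrow> ennreal) \<Rightarrow> (ennreal \<Rightarrow> ennreal) \<Rightarrow> bool" where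
  "smallest_orlicz_target n A B \<longleftrightarrow>
     young_function B \<and> maximal_bounded n A B \<and>
     (\<forall>D. young_function D \<longrightarrow> maximal_bounded n A D \<longrightarrow>
        (orlicz_space B :: (real ^ 'n \<Rightarrow> real) set) \<subseteq> orlicz_space D)"

end

theory Submission
  imports Defs
begin

text \<open>
  The proof reduces every statement to a scalar condition.  For Young functions \<open>A\<close> and \<open>D\<close>,
  the maximal operator maps \<open>L\<^sup>A\<close> into \<open>L\<^sup>D\<close> if and only if there is \<open>K\<close> such that
  \<open>\<integral>\<^sub>0\<^sup>t D(\<tau>) / \<tau>\<^sup>2 d\<tau> \<le> A(K t) / t\<close> for all \<open>t > 0\<close>; call such a \<open>D\<close> admissible.  Both directions use
  that \<open>D(\<sigma>) / \<sigma>\<close> is nondecreasing, so that \<open>D(u)\<close> lies between the integrals of \<open>D(\<sigma>) / \<sigma>\<close> over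
  \<open>(0, u)\<close> and over \<open>(0, 2 u)\<close>; by Fubini, modulars of \<open>M f\<close> then become integrals over the
  superlevel sets of \<open>M f\<close>.  Sufficiency comes from the weak type estimate
  \<open>|{M f > t}| \<le> (c / t) \<integral>\<^bsub>|f| > t/2\<^esub> |f|\<close> (\<open>maximal_function_weak_type\<close>), necessity from testing on
  multiples of indicators of cubes (\<open>maximal_bounded_cube_test\<close>).

  The rest is convex duality.  For a hinge \<open>D(\<tau>) = max 0 (r \<tau> - b)\<close> the condition reads
  \<open>r t ln (r t / b) - r t + b \<le> A(K t)\<close> for \<open>t > b / r\<close>.  The left-hand side is conjugate to
  \<open>b (exp (s / r) - 1)\<close>, so admissibility of the hinge amounts to
  \<open>A\<^sup>~(s / K) \<le> b (exp (s / r) - 1)\<close>.  Integrating against \<open>exp (-\<tau>)\<close> turns this into the bound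
  \<open>B\<^sub>A\<^sup>~(r / (2 K)) \<le> 2 b\<close>; conversely \<open>B\<^sub>A\<^sup>~(r) \<le> b\<close> makes the hinge with \<open>r\<close> and \<open>exp 1 * b\<close>
  admissible with \<open>K = 1\<close>.  So up to constants \<open>B\<^sub>A\<close> is the upper envelope of the hinges that are
  admissible with one and the same \<open>K\<close>, although \<open>B\<^sub>A\<close> itself need not be admissible.

  Two consequences finish the argument.  If \<open>D\<close> is admissible with constant \<open>K\<close>, then so is each
  of its supporting lines, whence \<open>D(x) \<le> B\<^sub>A(4 K x)\<close> (\<open>le_of_slope_integral_bound\<close>); hence
  \<open>L\<^sup>D\<close> contains \<open>L\<close> of \<open>B\<^sub>A\<close>, and no target exists at all if \<open>B\<^sub>A\<^sup>~\<close> is infinite on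
  \<open>(0, \<infinity>)\<close>.  If \<open>L\<^sup>B\<close> is a smallest target, then \<open>B\<^sub>A(x) \<le> B(C x)\<close> for some \<open>C\<close>: otherwise one
  picks hinges below \<open>B\<^sub>A\<close> that exceed \<open>B\<close> by larger and larger factors, and their weighted sum is
  an admissible Young function whose Orlicz space does not contain \<open>L\<^sup>B\<close>
  (\<open>smallest_orlicz_target_dominates\<close>).  Then \<open>M\<close> is bounded into the space of \<open>B\<^sub>A\<close> as well.
\<close>

section \<open>Young functions\<close>

lemma young_function_0: "young_function A \<Longrightarrow> A 0 = 0"
  by (simp add: young_function_def)

lemma young_function_scale_le:
  assumes "young_function A" "0 \<le> s" "s \<le> 1"
  shows "A (ennreal s * x) \<le> ennreal s * A x"
proof -
  have "A (ennreal s * x + ennreal (1 - s) * 0) \<le> ennreal s * A x + ennreal (1 - s) * A 0"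
    by (rule assms(1)[unfolded young_function_def, THEN conjunct1, rule_format])
      (use assms in simp)
  then show ?thesis by (simp add: young_function_0[OF assms(1)])
qed

lemma young_function_scale_ge:
  assumes "young_function D" "1 \<le> c"
  shows "ennreal c * D x \<le> D (ennreal c * x)"
proof -
  have "D (ennreal (1 / c) * (ennreal c * x)) \<le> ennreal (1 / c) * D (ennreal c * x)"
    using assms by (intro young_function_scale_le) auto
  also have "ennreal (1 / c) * (ennreal c * x) = x"
    using assms by (simp flip: mult.assoc ennreal_mult)
  finally have "ennreal c * D x \<le> ennreal c * (ennreal (1 / c) * D (ennreal c * x))"
    by (rule mult_left_mono) simp
  also have "\<dots> = D (ennreal c * x)" using assms by (simp flip: mult.assoc ennreal_mult)
  finally show ?thesis .
qed

lemma young_function_mono_finite: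
  assumes "young_function A" "x \<le> y" "y < \<infinity>"
  shows "A x \<le> A y"
proof -
  obtain a b where ab: "x = ennreal a" "y = ennreal b" "0 \<le> a" "0 \<le> b"
    using assms by (metis ennreal_cases infinity_ennreal_def less_le_not_le top_greatest)
  show ?thesis
  proof (cases "b = 0")
    case True
    then show ?thesis using ab assms by (auto simp: young_function_0)
  next
    case False
    have s: "0 \<le> a / b" "a / b \<le> 1" using ab assms False by auto
    have "A x = A (ennreal (a / b) * y)" using ab False by (simp flip: ennreal_mult)
    also have "\<dots> \<le> ennreal (a / b) * A y" by (rule young_function_scale_le[OF assms(1) s])
    also have "\<dots> \<le> 1 * A y" using s by (intro mult_right_mono) auto
    finally show ?thesis by simp
  qed
qed

lemma at_left_ennreal_neq_bot: "0 < (x::ennreal) \<Longrightarrow> at_left x \<noteq> bot"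
  unfolding trivial_limit_def using dense by (auto simp: eventually_at_left)

text \<open>Left-continuity enters the argument through this rule, also at \<open>x = \<infinity>\<close>.\<close>

lemma young_function_le_of_lt:
  assumes "young_function A" "0 < x" "\<And>y. y < x \<Longrightarrow> A y \<le> c"
  shows "A x \<le> c"
proof (rule tendsto_upperbound)
  show "(A \<longlongrightarrow> A x) (at_left x)" using assms(1) by (simp add: young_function_def)
  show "\<forall>\<^sub>F y in at_left x. A y \<le> c"
    using assms(2,3) by (auto simp: eventually_at_left intro!: exI[of _ 0])
  show "at_left x \<noteq> bot" by (rule at_left_ennreal_neq_bot[OF assms(2)])
qed

text \<open>Convexity on the segment from 0 to \<open>\<infinity>\<close> gives \<open>A \<infinity> \<le> A \<infinity> / 2\<close>, so \<open>A \<infinity>\<close> is 0 or \<open>\<infinity>\<close>; the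
  value 0 would force \<open>A\<close> to vanish identically.\<close>

lemma young_function_top:
  assumes "young_function A"
  shows "A \<infinity> = \<infinity>"
proof -
  have 1: "A \<infinity> \<le> ennreal (1/2) * A \<infinity>"
    using young_function_scale_le[OF assms, of "1/2" \<infinity>] by (simp add: ennreal_mult_top)
  have pos: "A \<infinity> \<noteq> 0"
  proof
    assume z: "A \<infinity> = 0"
    have lim: "(A \<longlongrightarrow> A \<infinity>) (at_left \<infinity>)" using assms unfolding young_function_def by blast
    have "A t \<le> 0" if "t < \<infinity>" for t
    proof -
      have "A t \<le> A \<infinity>"
      proof (rule tendsto_lowerbound[OF lim])
        show "\<forall>\<^sub>F y in at_left \<infinity>. A t \<le> A y"
          using that young_function_mono_finite[OF assms]
          by (auto simp: eventually_at_left[of 0] intro!: exI[of _ t])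
        show "at_left (\<infinity>::ennreal) \<noteq> bot" by (rule at_left_ennreal_neq_bot) simp
      qed
      then show ?thesis using z by simp
    qed
    then have "A t = 0" for t using z by (cases "t = \<infinity>") (auto simp: less_top)
    then show False using assms by (auto simp: young_function_def)
  qed
  show ?thesis
  proof (rule ccontr)
    assume fin: "A \<infinity> \<noteq> \<infinity>"
    obtain a where a: "A \<infinity> = ennreal a" "0 \<le> a" using fin by (cases "A \<infinity>") auto
    have "a \<le> a / 2" using 1 a by (simp flip: ennreal_mult add: ennreal_le_iff2 del: ennreal_half)
    then show False using pos a by simp
  qed
qed

lemma young_function_mono: "young_function A \<Longrightarrow> x \<le> y \<Longrightarrow> A x \<le> A y"
  using young_function_mono_finite[of A x y] young_function_top[of A]
  by (cases "y = \<infinity>") (auto simp: less_top)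

lemma young_function_finite_point:
  assumes "young_function A"
  obtains t where "0 < t" "A (ennreal t) < \<infinity>"
proof -
  obtain x where x: "0 < x" "A x \<noteq> \<infinity>" using assms by (auto simp: young_function_def)
  then have "x \<noteq> \<infinity>" using young_function_top[OF assms] by auto
  then show thesis using that[of "enn2real x"] x by (cases x) (auto simp: less_top)
qed

lemma young_function_less_left:
  assumes "young_function D" "0 < \<tau>" "c < D (ennreal \<tau>)"
  obtains \<sigma> where "0 < \<sigma>" "\<sigma> < \<tau>" "c < D (ennreal \<sigma>)"
proof -
  have "\<exists>y<ennreal \<tau>. c < D y"
  proof (rule ccontr)
    assume neg: "\<not> (\<exists>y<ennreal \<tau>. c < D y)"
    have "D (ennreal \<tau>) \<le> c"
    proof (rule young_function_le_of_lt[OF assms(1)])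
      show "0 < ennreal \<tau>" using assms(2) by simp
      fix y assume "y < ennreal \<tau>"
      then show "D y \<le> c" using neg not_less by blast
    qed
    then show False using assms(3) by simp
  qed
  then obtain y where y: "y < ennreal \<tau>" "c < D y" by blast
  then obtain \<sigma> where \<sigma>: "y = ennreal \<sigma>" "0 \<le> \<sigma>" by (cases y) auto
  have "\<sigma> \<noteq> 0" using y(2) \<sigma> young_function_0[OF assms(1)] by auto
  then show thesis using that[of \<sigma>] y \<sigma> by (auto simp: ennreal_less_iff)
qed

lemma young_function_convex_combination:
  assumes "young_function D" "0 \<le> u" "0 \<le> v" "u + v = 1" "0 \<le> x" "0 \<le> y"
  shows "D (ennreal (u * x + v * y)) \<le> ennreal u * D (ennreal x) + ennreal v * D (ennreal y)"
proof -
  have v: "v = 1 - u" using assms by simp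
  have "D (ennreal u * ennreal x + ennreal (1 - u) * ennreal y)
      \<le> ennreal u * D (ennreal x) + ennreal (1 - u) * D (ennreal y)"
    by (rule assms(1)[unfolded young_function_def, THEN conjunct1, rule_format]) (use assms in simp)
  moreover have "ennreal u * ennreal x + ennreal (1 - u) * ennreal y = ennreal (u * x + v * y)"
    using assms v by (simp flip: ennreal_mult ennreal_plus)
  ultimately show ?thesis using v by simp
qed

lemma borel_measurable_mono_ennreal:
  fixes f :: "ennreal \<Rightarrow> ennreal"
  assumes "mono f"
  shows "f \<in> borel_measurable borel"
proof (rule borel_measurableI_greater)
  fix c
  let ?U = "{x. c < f x}"
  have up: "y \<in> ?U" if "x \<in> ?U" "x \<le> y" for x y
    using that monoD[OF assms] by (auto intro: less_le_trans)
  have "?U = (if Inf ?U \<in> ?U then {Inf ?U..} else {Inf ?U<..})"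
  proof (cases "Inf ?U \<in> ?U")
    case True
    have "?U = {Inf ?U..}"
    proof safe
      fix x assume "c < f x" then show "Inf ?U \<le> x" by (intro Inf_lower) simp
    next
      fix x assume "Inf ?U \<le> x" with True show "c < f x" using up by blast
    qed
    with True show ?thesis by simp
  next
    case False
    have "?U = {Inf ?U<..}"
    proof safe
      fix x assume x: "c < f x"
      have "Inf ?U \<le> x" by (rule Inf_lower) (simp add: x)
      moreover have "Inf ?U \<noteq> x" using False x by force
      ultimately show "Inf ?U < x" by simp
    next
      fix x assume "Inf ?U < x"
      then obtain y where "y \<in> ?U" "y < x" using Inf_less_iff by blast
      then show "c < f x" using up[of y x] by simp
    qed
    with False show ?thesis by simp
  qed
  moreover have "(if Inf ?U \<in> ?U then {Inf ?U..} else {Inf ?U<..}) \<in> sets borel"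
    by simp
  ultimately show "{x \<in> space borel. c < f x} \<in> sets borel" by simp
qed

lemma young_function_measurable: "young_function A \<Longrightarrow> A \<in> borel_measurable borel"
  by (rule borel_measurable_mono_ennreal) (auto intro: monoI young_function_mono)

lemma young_function_ratio_mono:
  assumes "young_function A" "0 < a" "a \<le> b"
  shows "A (ennreal a) / ennreal a \<le> A (ennreal b) / ennreal b"
proof -
  have s: "0 \<le> a / b" "a / b \<le> 1" using assms by auto
  have "A (ennreal a) = A (ennreal (a / b) * ennreal b)" using assms by (simp flip: ennreal_mult)
  also have "\<dots> \<le> ennreal (a / b) * A (ennreal b)" by (rule young_function_scale_le[OF assms(1) s])
  finally have "A (ennreal a) / ennreal a \<le> ennreal (a / b) * A (ennreal b) / ennreal a"
    by (rule divide_right_mono_ennreal)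
  also have "\<dots> = ennreal (a / b) / ennreal a * A (ennreal b)"
    by (simp add: ennreal_times_divide mult.commute)
  also have "ennreal (a / b) / ennreal a = inverse (ennreal b)"
    using assms by (simp add: divide_ennreal inverse_ennreal field_simps)
  also have "inverse (ennreal b) * A (ennreal b) = A (ennreal b) / ennreal b"
    by (simp add: divide_ennreal_def mult.commute)
  finally show ?thesis .
qed

text \<open>Since \<open>D \<sigma> / \<sigma>\<close> is nondecreasing, it is at least \<open>D u / u\<close> on an interval of length \<open>u\<close> to the
  right of \<open>u\<close>.  Together with the next lemma this replaces the representation of \<open>D\<close> as the
  integral of its density.\<close>

lemma young_function_le_slope_integral:
  assumes "young_function D"
  shows "D u \<le> (\<integral>\<^sup>+\<sigma>\<in>{\<sigma>. 0 < \<sigma> \<and> ennreal \<sigma> < 2 * u}. D (ennreal \<sigma>) / ennreal \<sigma> \<partial>lborel)"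
    (is "_ \<le> ?I u")
proof -
  have *: "D (ennreal c) \<le> ?I (ennreal c)" if "0 < c" for c
  proof -
    have "D (ennreal c) = D (ennreal c) / ennreal c * emeasure lborel {c..<2*c}"
      using that by (simp add: ennreal_divide_times mult_divide_eq_ennreal)
    also have "\<dots> = (\<integral>\<^sup>+\<sigma>. D (ennreal c) / ennreal c * indicator {c..<2*c} \<sigma> \<partial>lborel)"
      by (rule nn_integral_cmult_indicator[symmetric]) simp
    also have "\<dots> \<le> ?I (ennreal c)"
      using that young_function_ratio_mono[OF assms]
      by (intro nn_integral_mono) (auto split: split_indicator simp: ennreal_less_iff mult.commute[of _ 2] simp flip: ennreal_numeral ennreal_mult)
    finally show ?thesis .
  qed
  show ?thesis
  proof (cases "u = 0")
    case True
    then show ?thesis by (simp add: young_function_0[OF assms])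
  next
    case False
    show ?thesis
    proof (rule young_function_le_of_lt[OF assms])
      show "0 < u" using False by (simp add: zero_less_iff_neq_zero)
      fix y assume y: "y < u"
      show "D y \<le> ?I u"
      proof (cases "y = 0")
        case True
        then show ?thesis by (simp add: young_function_0[OF assms])
      next
        case False
        obtain c where c: "y = ennreal c" "0 \<le> c" using y by (cases y) auto
        have "D y \<le> ?I y" using * c False by (auto simp: le_less)
        also have "\<dots> \<le> ?I u"
          using y by (intro nn_integral_mono)
            (auto split: split_indicator dest: less_le_trans[OF _ mult_left_mono[of y u 2]])
        finally show ?thesis .
      qed
    qed
  qed
qed

lemma slope_integral_le_young_function:
  assumes "young_function D"
  shows "(\<integral>\<^sup>+\<sigma>\<in>{\<sigma>. 0 < \<sigma> \<and> ennreal \<sigma> \<le> u}. D (ennreal \<sigma>) / ennreal \<sigma> \<partial>lborel) \<le> D u"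
proof (cases u)
  case top
  then show ?thesis using young_function_top[OF assms] by simp
next
  case (real c)
  show ?thesis
  proof (cases "c = 0")
    case True
    then have "{\<sigma>. 0 < \<sigma> \<and> ennreal \<sigma> \<le> u} = {}" using real by (auto simp: ennreal_eq_0_iff)
    then show ?thesis by simp
  next
    case False
    have "(\<integral>\<^sup>+\<sigma>\<in>{\<sigma>. 0 < \<sigma> \<and> ennreal \<sigma> \<le> u}. D (ennreal \<sigma>) / ennreal \<sigma> \<partial>lborel)
        \<le> (\<integral>\<^sup>+\<sigma>. D (ennreal c) / ennreal c * indicator {0<..c} \<sigma> \<partial>lborel)"
      using real young_function_ratio_mono[OF assms]
      by (intro nn_integral_mono) (auto split: split_indicator)
    also have "\<dots> = D (ennreal c) / ennreal c * emeasure lborel {0<..c}"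
      by (rule nn_integral_cmult_indicator) simp
    also have "\<dots> = D u"
      using real False by (simp add: ennreal_divide_times mult_divide_eq_ennreal)
    finally show ?thesis .
  qed
qed

text \<open>A Young function is the supremum of its affine minorants.  Where it is finite to the right of the
  point considered, a subgradient provides the minorant; where it has already jumped to \<open>\<infinity>\<close>, a
  steep line through the end of its domain of finiteness does.  The strict inequality for
  \<open>m\<close> leaves room to make the intercept \<open>b\<close> positive.\<close>

lemma young_function_supporting_line:
  assumes D: "young_function D" and \<tau>: "0 < \<tau>" and m: "0 \<le> m" "ennreal m < D (ennreal \<tau>)"
  obtains r b where "0 < r" "0 < b" "m < r * \<tau> - b"
    "\<And>\<sigma>. 0 \<le> \<sigma> \<Longrightarrow> ennreal (r * \<sigma> - b) \<le> D (ennreal \<sigma>)"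
proof -
  obtain q where q: "0 < q" "q < \<tau>" "ennreal m < D (ennreal q)"
    using young_function_less_left[OF D \<tau> m(2)] .
  obtain p where p: "0 < p" "p < q" "ennreal m < D (ennreal p)"
    using young_function_less_left[OF D q(1,3)] .
  define I where "I = {y. 0 \<le> y \<and> D (ennreal y) < \<infinity>}"
  show thesis
  proof (cases "D (ennreal q) = \<infinity>")
    case True
    have up: "y < q" if "y \<in> I" for y
    proof (rule ccontr)
      assume "\<not> y < q"
      then have "D (ennreal q) \<le> D (ennreal y)"
        by (intro young_function_mono[OF D] ennreal_leI) simp
      then show False using that True by (simp add: I_def top_unique)
    qed
    then have bdd: "bdd_above I" by (intro bdd_aboveI[of _ q]) (auto intro: less_imp_le)
    obtain t where t: "0 < t" "D t \<noteq> \<infinity>" using D by (auto simp: young_function_def)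
    then have "t \<noteq> \<infinity>" using young_function_top[OF D] by auto
    then have "t < \<infinity>" by (simp add: less_top)
    then obtain t' where t': "t = ennreal t'" "0 \<le> t'" by (cases t) auto
    have "t' \<in> I" using t t' by (simp add: I_def less_top)
    \<comment> \<open>\<open>D\<close> is infinite to the right of \<open>T < \<tau>\<close>, so every line of positive slope through \<open>(T, 0)\<close> is a minorant.\<close>
    define T where "T = Sup I"
    have T: "t' \<le> T" "T \<le> q"
      using cSup_upper[OF \<open>t' \<in> I\<close> bdd] cSup_least[of I q] \<open>t' \<in> I\<close> up unfolding T_def
      by (auto intro: less_imp_le)
    have "0 < T" using T t t' by auto
    define r where "r = (m + 1) / (\<tau> - T)"
    have "T < \<tau>" using T q by simp
    then have r: "0 < r" using m by (simp add: r_def)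
    show thesis
    proof (rule that[of r "r * T"])
      show "0 < r * T" using r \<open>0 < T\<close> by simp
      have "r * (\<tau> - T) = m + 1" using \<open>T < \<tau>\<close> by (simp add: r_def)
      then show "m < r * \<tau> - r * T" by (simp add: algebra_simps)
      fix \<sigma> :: real assume "0 \<le> \<sigma>"
      show "ennreal (r * \<sigma> - r * T) \<le> D (ennreal \<sigma>)"
      proof (cases "\<sigma> \<le> T")
        case True
        then have "r * \<sigma> - r * T \<le> 0" using r by simp
        then show ?thesis by (simp add: ennreal_neg)
      next
        case False
        then have "\<sigma> \<notin> I" using cSup_upper[OF _ bdd] unfolding T_def by force
        then have "D (ennreal \<sigma>) = \<infinity>" using \<open>0 \<le> \<sigma>\<close> by (simp add: I_def less_top[symmetric])
        then show ?thesis by simp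
      qed
    qed (rule r)
  next
    case False
    define d where "d y = enn2real (D (ennreal y))" for y
    have d: "D (ennreal y) = ennreal (d y)" "0 \<le> d y" if "y \<in> I" for y
      using that by (auto simp: d_def I_def)
    have comb: "u * x + v * y \<in> I \<and> d (u * x + v * y) \<le> u * d x + v * d y"
      if "0 \<le> u" "0 \<le> v" "u + v = 1" "x \<in> I" "y \<in> I" for u v x y
    proof -
      have xy: "0 \<le> x" "0 \<le> y" using that by (auto simp: I_def)
      have le: "D (ennreal (u * x + v * y)) \<le> ennreal (u * d x + v * d y)"
        using young_function_convex_combination[OF D that(1-3) xy] d that
        by (simp add: ennreal_mult)
      then have "u * x + v * y \<in> I"
        using xy that by (auto simp: I_def intro: le_less_trans)
      moreover have "d (u * x + v * y) \<le> u * d x + v * d y"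
        using le that d unfolding d_def[of "u * x + v * y"] by (intro enn2real_leI) auto
      ultimately show ?thesis ..
    qed
    have cvx: "convex_on I d"
      unfolding convex_on_def convex_def using comb by auto
    have "{0<..<q} \<subseteq> I"
    proof
      fix x assume x: "x \<in> {0<..<q}"
      then have "D (ennreal x) \<le> D (ennreal q)"
        by (intro young_function_mono[OF D] ennreal_leI) simp
      also have "\<dots> < \<infinity>" using False by (simp add: less_top)
      finally show "x \<in> I" using x by (simp add: I_def)
    qed
    then have "{0<..<q} \<subseteq> interior I" by (intro interior_maximal) auto
    then have pI: "p \<in> interior I" using p by auto
    have pI': "p \<in> I" using pI interior_subset by blast
    define r where "r = Inf ((\<lambda>t. (d p - d t) / (p - t)) ` ({p<..} \<inter> I))"
    have line: "d y \<ge> d p + r * (y - p)" if "y \<in> I" for y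
      unfolding r_def by (rule convex_le_Inf_differential[OF cvx pI that])
    have dp: "m < d p" using p(3) d[OF pI'] m by (simp add: ennreal_less_iff)
    have "0 \<in> I" "d 0 = 0" using young_function_0[OF D] by (auto simp: I_def d_def)
    then have rp: "d p \<le> r * p" using line[of 0] by simp
    then have "0 < r * p" using dp m by linarith
    then have r: "0 < r" using p by (simp add: zero_less_mult_iff)
    \<comment> \<open>The tangent at \<open>p\<close> is lowered by half of the gap \<open>d p - m\<close>, so that its intercept is strictly negative.\<close>
    define b where "b = r * p - d p + (d p - m) / 2"
    show thesis
    proof (rule that[of r b])
      show "0 < b" using rp dp unfolding b_def by argo
      have "r * p < r * \<tau>" using r p q by simp
      then show "m < r * \<tau> - b" using dp by (simp add: b_def field_simps)
      fix \<sigma> :: real assume \<sigma>: "0 \<le> \<sigma>"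
      show "ennreal (r * \<sigma> - b) \<le> D (ennreal \<sigma>)"
      proof (cases "\<sigma> \<in> I")
        case True
        have "r * \<sigma> - b \<le> d \<sigma>" using line[OF True] dp by (simp add: b_def field_simps)
        then show ?thesis using d[OF True] by (simp add: ennreal_leI)
      next
        case False
        then have "D (ennreal \<sigma>) = \<infinity>" using \<sigma> by (simp add: I_def less_top[symmetric])
        then show ?thesis by simp
      qed
    qed (rule r)
  qed
qed

section \<open>Complementary functions and exponential averages\<close>

lemma young_inequality:
  assumes "0 < \<tau>"
  shows "ennreal \<tau> * s \<le> A (ennreal \<tau>) + complementary A s"
proof -
  have "ennreal \<tau> * s - A (ennreal \<tau>) \<le> complementary A s"
    unfolding complementary_def using assms by (intro SUP_upper) auto
  then show ?thesis unfolding ennreal_minus_le_iff by blast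
qed

text \<open>The finiteness of \<open>s\<close> excludes the ambiguous difference \<open>\<infinity> - \<infinity>\<close>.\<close>

lemma complementary_leI:
  assumes "\<And>u. 0 < u \<Longrightarrow> ennreal u * s \<le> A (ennreal u) + c" "s < \<infinity>"
  shows "complementary A s \<le> c"
  unfolding complementary_def
proof (rule SUP_least)
  fix \<tau> :: ennreal assume "\<tau> \<in> {0<..<\<infinity>}"
  then obtain u where u: "\<tau> = ennreal u" "0 < u" by (cases \<tau>) auto
  have "ennreal u * s \<noteq> top" using assms(2) by (auto simp: ennreal_mult_eq_top_iff)
  then show "\<tau> * s - A \<tau> \<le> c"
    unfolding ennreal_minus_le_iff using assms(1)[OF u(2)] u by auto
qed

lemma complementary_mono: "s \<le> s' \<Longrightarrow> complementary A s \<le> complementary A s'"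
  unfolding complementary_def by (intro SUP_mono') (auto intro!: ennreal_minus_mono mult_left_mono)

lemma complementary_scale_le:
  assumes "0 \<le> v" "v \<le> 1"
  shows "complementary A (ennreal v * s) \<le> ennreal v * complementary A s"
  unfolding complementary_def SUP_mult_left_ennreal
proof (rule SUP_mono')
  fix \<tau> :: ennreal
  \<comment> \<open>Only the linear term is scaled, so \<open>A \<tau>\<close> may be replaced by the smaller \<open>v A \<tau>\<close>.\<close>
  have "ennreal v * A \<tau> \<le> 1 * A \<tau>" using assms by (intro mult_right_mono) auto
  then have "\<tau> * (ennreal v * s) - A \<tau> \<le> ennreal v * (\<tau> * s) - ennreal v * A \<tau>"
    by (intro ennreal_minus_mono) (auto simp: mult_ac)
  also have "\<dots> \<le> ennreal v * (\<tau> * s - A \<tau>)"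
    by (cases "ennreal v = 0"; cases "A \<tau> = top"; cases "\<tau> * s")
      (auto simp: ennreal_right_diff_distrib minus_top_ennreal ennreal_mult_top ennreal_mult_eq_top_iff)
  finally show "\<tau> * (ennreal v * s) - A \<tau> \<le> ennreal v * (\<tau> * s - A \<tau>)" .
qed

text \<open>For the hinge \<open>max 0 (r \<tau> - b)\<close> the integral is elementary, with antiderivative
  \<open>r ln \<tau> + b / \<tau>\<close> to the right of the corner \<open>b / r\<close>.\<close>

lemma nn_integral_hinge:
  fixes r b t :: real
  assumes "0 < r" "0 < b" "0 < t"
  shows "(\<integral>\<^sup>+\<tau>\<in>{0<..<t}. ennreal (r * \<tau> - b) / ennreal (\<tau>\<^sup>2) \<partial>lborel)
    = (if t \<le> b / r then 0 else ennreal (r * ln (t * r / b) - r + b / t))"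
proof (cases "t \<le> b / r")
  case True
  have "ennreal (r * \<tau> - b) = 0" if "\<tau> < t" for \<tau>
  proof -
    have "\<tau> \<le> b / r" using True that by simp
    then have "r * \<tau> - b \<le> 0" using assms by (simp add: field_simps)
    then show ?thesis by (rule ennreal_neg)
  qed
  then have "(\<integral>\<^sup>+\<tau>\<in>{0<..<t}. ennreal (r * \<tau> - b) / ennreal (\<tau>\<^sup>2) \<partial>lborel) = (\<integral>\<^sup>+\<tau>. 0 \<partial>(lborel :: real measure))"
    by (intro nn_integral_cong) (auto split: split_indicator)
  then show ?thesis using True by simp
next
  case False
  define a where "a = b / r"
  have a: "0 < a" "a < t" using False assms by (auto simp: a_def)
  have "AE \<tau> in lborel. \<tau> \<noteq> t" by (rule AE_lborel_singleton)
  then have "(\<integral>\<^sup>+\<tau>\<in>{0<..<t}. ennreal (r * \<tau> - b) / ennreal (\<tau>\<^sup>2) \<partial>lborel)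
      = (\<integral>\<^sup>+\<tau>. ennreal ((r * \<tau> - b) / \<tau>\<^sup>2) * indicator {a..t} \<tau> \<partial>lborel)"
  proof (intro nn_integral_cong_AE, eventually_elim)
    fix \<tau> assume "\<tau> \<noteq> t"
    show "ennreal (r * \<tau> - b) / ennreal (\<tau>\<^sup>2) * indicator {0<..<t} \<tau>
        = ennreal ((r * \<tau> - b) / \<tau>\<^sup>2) * indicator {a..t} \<tau>"
    proof (cases "a \<le> \<tau>")
      case True
      then have "0 \<le> r * \<tau> - b" using assms by (simp add: a_def field_simps)
      moreover have "0 < \<tau>" using True a by simp
      ultimately show ?thesis using True \<open>\<tau> \<noteq> t\<close> by (auto split: split_indicator simp: divide_ennreal)
    next
      case False
      then have "r * \<tau> - b \<le> 0" using assms by (simp add: a_def field_simps)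
      then show ?thesis using False by (simp add: ennreal_neg)
    qed
  qed
  also have "\<dots> = ennreal ((r * ln t + b / t) - (r * ln a + b / a))"
  proof (rule nn_integral_FTC_Icc)
    fix x assume xa: "x \<in> {a..t}"
    then have x: "0 < x" using a by simp
    show "DERIV (\<lambda>x. r * ln x + b / x) x :> (r * x - b) / x\<^sup>2"
      using x by (auto intro!: derivative_eq_intros simp: field_simps power2_eq_square)
    show "0 \<le> (r * x - b) / x\<^sup>2"
      using xa assms by (auto simp: a_def field_simps)
  qed (use a in auto)
  also have "(r * ln t + b / t) - (r * ln a + b / a) = r * ln (t * r / b) - r + b / t"
  proof -
    have "ln (t * r / b) = ln t - ln a"
      using assms by (simp add: a_def ln_div ln_mult)
    moreover have "b / a = r" using assms by (simp add: a_def)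
    ultimately show ?thesis by (simp only: right_diff_distrib)
  qed
  finally show ?thesis using False by simp
qed

text \<open>With \<open>w = t r / b\<close>, the hypothesis says \<open>b (w ln w - w + 1) \<le> A(K t)\<close>.  The convex
  conjugate of \<open>w ln w - w + 1\<close> is \<open>exp v - 1\<close>, so the claim follows from
  \<open>w v \<le> w ln w - w + exp v\<close> for \<open>v = s / r\<close>, that is, \<open>1 + x \<le> exp x\<close> at \<open>x = v - ln w\<close>.\<close>

lemma complementary_le_exp:
  assumes "0 < r" "0 < b" "0 < K" "0 \<le> s"
    and "\<And>t. b / r < t \<Longrightarrow> ennreal (r * ln (t * r / b) - r + b / t) \<le> A (ennreal (K * t)) / ennreal t"
  shows "complementary A (ennreal (s / K)) \<le> ennreal (b * exp (s / r))"
proof (rule complementary_leI)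
  fix u :: real assume u: "0 < u"
  define t where "t = u / K"
  have t: "0 < t" "u = K * t" using u assms by (auto simp: t_def)
  have ts: "ennreal u * ennreal (s / K) = ennreal (t * s)"
    using t assms by (simp flip: ennreal_mult)
  show "ennreal u * ennreal (s / K) \<le> A (ennreal u) + ennreal (b * exp (s / r))"
  proof (cases "t \<le> b / r")
    case True
    have "t * s \<le> b / r * s" using True assms by (intro mult_right_mono) auto
    also have "\<dots> = b * (s / r)" by simp
    also have "s / r \<le> exp (s / r)" using exp_ge_add_one_self[of "s / r"] by linarith
    then have "b * (s / r) \<le> b * exp (s / r)" using assms by (intro mult_left_mono) auto
    finally have "ennreal (t * s) \<le> ennreal (b * exp (s / r))" by (rule ennreal_leI)
    then show ?thesis unfolding ts by (simp add: add_increasing)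
  next
    case False
    define w where "w = t * r / b"
    have w: "1 < w" "t = w * b / r" using False assms by (auto simp: w_def field_simps)
    let ?h = "r * t * ln w - r * t + b"
    have "ennreal (r * ln w - r + b / t) * ennreal t \<le> A (ennreal (K * t)) / ennreal t * ennreal t"
      unfolding w_def using assms(5)[of t] False by (intro mult_right_mono) auto
    also have "A (ennreal (K * t)) / ennreal t * ennreal t = A (ennreal u)"
      using t by (simp add: ennreal_divide_times mult_divide_eq_ennreal)
    also have "ennreal (r * ln w - r + b / t) * ennreal t = ennreal ((r * ln w - r + b / t) * t)"
      using t by (intro ennreal_mult''[symmetric]) simp
    also have "(r * ln w - r + b / t) * t = ?h" using t by (simp add: field_simps)
    finally have A: "ennreal ?h \<le> A (ennreal u)" .
    have "1 + (s / r - ln w) \<le> exp (s / r - ln w)" by (rule exp_ge_add_one_self)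
    also have "\<dots> = exp (s / r) / w" using w by (simp add: exp_diff)
    finally have "w * (1 + (s / r - ln w)) \<le> exp (s / r)" using w by (simp add: field_simps)
    then have "b * (w * (1 + (s / r - ln w))) \<le> b * exp (s / r)" using assms by simp
    moreover have "b * (w * (1 + (s / r - ln w))) = r * t + t * s - r * t * ln w"
      using w(2) assms by (simp add: field_simps)
    ultimately have "t * s \<le> ?h + b * exp (s / r)" using assms by linarith
    then have "ennreal (t * s) \<le> ennreal ?h + ennreal (b * exp (s / r))"
      using ennreal_leI[of "t * s" "?h + b * exp (s / r)"] assms
      by (auto simp: ennreal_plus_if intro: order_trans split: if_splits)
    also have "\<dots> \<le> A (ennreal u) + ennreal (b * exp (s / r))" using A by (rule add_right_mono)
    finally show ?thesis unfolding ts .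
  qed
qed simp

lemma exp_minus_at_top: "((\<lambda>x::real. exp (- x)) \<longlongrightarrow> 0) at_top"
  by (rule filterlim_compose[OF exp_at_bot filterlim_uminus_at_bot_at_top])

lemma nn_integral_exp_half:
  assumes "0 \<le> b"
  shows "(\<integral>\<^sup>+\<tau>\<in>{0<..}. ennreal (b * exp (- \<tau> / 2)) \<partial>lborel) \<le> ennreal (2 * b)"
proof -
  have "(\<integral>\<^sup>+\<tau>\<in>{0<..}. ennreal (b * exp (- \<tau> / 2)) \<partial>lborel)
      \<le> (\<integral>\<^sup>+\<tau>. ennreal (b * exp (- \<tau> / 2)) * indicator {0..} \<tau> \<partial>lborel)"
    by (intro nn_integral_mono) (auto split: split_indicator)
  also have "\<dots> = ennreal (0 - (\<lambda>\<tau>::real. - 2 * b * exp (- \<tau> / 2)) 0)"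
  proof (rule nn_integral_FTC_atLeast)
    show "DERIV (\<lambda>\<tau>. - 2 * b * exp (- \<tau> / 2)) x :> b * exp (- x / 2)" for x :: real
      by (auto intro!: derivative_eq_intros)
    have "filterlim (\<lambda>\<tau>::real. 1 / 2 * \<tau>) at_top at_top"
      by (rule filterlim_tendsto_pos_mult_at_top[OF tendsto_const _ filterlim_ident]) simp
    from filterlim_compose[OF exp_minus_at_top this]
    have "((\<lambda>\<tau>::real. exp (- \<tau> / 2)) \<longlongrightarrow> 0) at_top" by simp
    then show "((\<lambda>\<tau>::real. - 2 * b * exp (- \<tau> / 2)) \<longlongrightarrow> 0) at_top"
      by (rule tendsto_mult_right_zero)
  qed (use assms in auto)
  finally show ?thesis by simp
qed

text \<open>The factor 2 in \<open>r / (2 * K)\<close> halves the growth rate of the bound, which makes it integrable against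
  \<open>exp (- \<tau>)\<close>.\<close>

lemma exp_average_complementary_le:
  assumes "0 < r" "0 < b" "0 < K"
    and "\<And>s. 0 \<le> s \<Longrightarrow> complementary A (ennreal (s / K)) \<le> ennreal (b * exp (s / r))"
  shows "exp_average_complementary A (ennreal (r / (2 * K))) \<le> ennreal (2 * b)"
proof -
  have "exp_average_complementary A (ennreal (r / (2 * K)))
      \<le> (\<integral>\<^sup>+\<tau>\<in>{0<..}. ennreal (b * exp (- \<tau> / 2)) \<partial>lborel)"
    unfolding exp_average_complementary_def
  proof (rule nn_integral_mono)
    fix \<tau> :: real
    show "complementary A (ennreal (r / (2 * K)) * ennreal \<tau>) * ennreal (exp (- \<tau>)) * indicator {0<..} \<tau>
        \<le> ennreal (b * exp (- \<tau> / 2)) * indicator {0<..} \<tau>"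
    proof (cases "0 < \<tau>")
      case True
      have "ennreal (r / (2 * K)) * ennreal \<tau> = ennreal ((r * \<tau> / 2) / K)"
        using assms True by (simp flip: ennreal_mult)
      then have "complementary A (ennreal (r / (2 * K)) * ennreal \<tau>) \<le> ennreal (b * exp (\<tau> / 2))"
        using assms(4)[of "r * \<tau> / 2"] assms True by simp
      then have "complementary A (ennreal (r / (2 * K)) * ennreal \<tau>) * ennreal (exp (- \<tau>))
          \<le> ennreal (b * exp (\<tau> / 2)) * ennreal (exp (- \<tau>))" by (rule mult_right_mono) simp
      also have "\<dots> = ennreal (b * exp (\<tau> / 2) * exp (- \<tau>))"
        using assms by (simp add: ennreal_mult)
      also have "b * exp (\<tau> / 2) * exp (- \<tau>) = b * exp (- \<tau> / 2)"
        by (simp add: mult.assoc flip: exp_add)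
      finally show ?thesis using True by simp
    qed simp
  qed
  also have "\<dots> \<le> ennreal (2 * b)" using assms by (intro nn_integral_exp_half) simp
  finally show ?thesis .
qed

lemma nn_integral_exp_tail:
  "(\<integral>\<^sup>+\<tau>\<in>{v..}. ennreal (exp (- \<tau>)) \<partial>lborel) = ennreal (exp (- v))"
proof -
  have "(\<integral>\<^sup>+\<tau>\<in>{v..}. ennreal (exp (- \<tau>)) \<partial>lborel) = ennreal (0 - (\<lambda>\<tau>::real. - exp (- \<tau>)) v)"
  proof (rule nn_integral_FTC_atLeast)
    show "DERIV (\<lambda>\<tau>::real. - exp (- \<tau>)) x :> exp (- x)" for x
      by (auto intro!: derivative_eq_intros)
    show "((\<lambda>\<tau>::real. - exp (- \<tau>)) \<longlongrightarrow> 0) at_top"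
      using tendsto_minus[OF exp_minus_at_top] by simp
  qed auto
  then show ?thesis by simp
qed

text \<open>The complementary function is nondecreasing, so the part of the average over \<open>\<tau> \<ge> v\<close> is at least
  its value at \<open>r v\<close> times the tail \<open>exp (- v)\<close>.\<close>

lemma complementary_le_exp_mult_average:
  assumes "exp_average_complementary A (ennreal r) \<le> ennreal b" "0 < r" "0 \<le> b" "0 < v"
  shows "complementary A (ennreal (r * v)) \<le> ennreal (b * exp v)"
proof -
  let ?c = "complementary A (ennreal (r * v))"
  have "?c * ennreal (exp (- v)) = (\<integral>\<^sup>+\<tau>. ?c * (ennreal (exp (- \<tau>)) * indicator {v..} \<tau>) \<partial>lborel)"
    by (subst nn_integral_cmult) (auto simp: nn_integral_exp_tail)
  also have "\<dots> \<le> exp_average_complementary A (ennreal r)"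
    unfolding exp_average_complementary_def
  proof (rule nn_integral_mono)
    fix \<tau> :: real
    show "?c * (ennreal (exp (- \<tau>)) * indicator {v..} \<tau>)
      \<le> complementary A (ennreal r * ennreal \<tau>) * ennreal (exp (- \<tau>)) * indicator {0<..} \<tau>"
    proof (cases "v \<le> \<tau>")
      case True
      have "?c \<le> complementary A (ennreal r * ennreal \<tau>)"
        using True assms by (intro complementary_mono) (auto simp flip: ennreal_mult intro!: ennreal_leI)
      then show ?thesis using True assms by (simp add: mult_right_mono)
    qed simp
  qed
  finally have "?c * ennreal (exp (- v)) \<le> ennreal b" using assms(1) by (rule order_trans)
  then have "?c * ennreal (exp (- v)) * ennreal (exp v) \<le> ennreal b * ennreal (exp v)"
    by (rule mult_right_mono) simp
  also have "?c * ennreal (exp (- v)) * ennreal (exp v) = ?c"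
    by (simp add: mult.assoc flip: ennreal_mult exp_add)
  also have "ennreal b * ennreal (exp v) = ennreal (b * exp v)" using assms by (simp add: ennreal_mult)
  finally show ?thesis .
qed

text \<open>The bound by \<open>b exp v\<close> does not vanish at 0.  For \<open>v \<le> 1\<close> the complementary function lies below its
  chord from the origin, which gives a bound linear in \<open>v\<close> and hence one by a multiple of
  \<open>exp v - 1\<close>; for \<open>v \<ge> 1\<close> the two bounds are comparable.\<close>

lemma complementary_le_exp_minus_one:
  assumes avg: "exp_average_complementary A (ennreal r) \<le> ennreal b" and r: "0 < r" and b: "0 \<le> b"
    and v: "0 < v"
  shows "complementary A (ennreal (r * v)) \<le> ennreal (exp 1 * b * (exp v - 1))"
proof (cases "v \<le> 1")
  case True
  have "complementary A (ennreal (r * v)) = complementary A (ennreal v * ennreal (r * 1))"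
    using r v by (simp add: mult.commute flip: ennreal_mult)
  also have "\<dots> \<le> ennreal v * complementary A (ennreal (r * 1))"
    using True v by (intro complementary_scale_le) auto
  also have "\<dots> \<le> ennreal v * ennreal (b * exp 1)"
    by (intro mult_left_mono complementary_le_exp_mult_average[OF avg r b]) auto
  also have "\<dots> = ennreal (v * (b * exp 1))" using v b by (simp add: ennreal_mult)
  also have "\<dots> \<le> ennreal (exp 1 * b * (exp v - 1))"
  proof (rule ennreal_leI)
    have "v \<le> exp v - 1" using exp_ge_add_one_self[of v] by linarith
    then have "b * exp 1 * v \<le> b * exp 1 * (exp v - 1)" using b by (intro mult_left_mono) auto
    then show "v * (b * exp 1) \<le> exp 1 * b * (exp v - 1)" by (simp add: mult_ac)
  qed
  finally show ?thesis .
next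
  case False
  have "complementary A (ennreal (r * v)) \<le> ennreal (b * exp v)"
    by (rule complementary_le_exp_mult_average[OF avg r b v])
  also have "\<dots> \<le> ennreal (exp 1 * b * (exp v - 1))"
  proof (rule ennreal_leI)
    have e: "2 \<le> exp (1::real)" using exp_ge_add_one_self[of 1] by simp
    have "exp 1 \<le> exp v" using False by simp
    then have "exp v + exp 1 \<le> exp v + exp v" by simp
    also have "\<dots> = 2 * exp v" by simp
    also have "\<dots> \<le> exp 1 * exp v" using e by (intro mult_right_mono) auto
    finally have "b * exp v \<le> b * (exp 1 * (exp v - 1))"
      using b by (intro mult_left_mono) (auto simp: algebra_simps)
    then show "b * exp v \<le> exp 1 * b * (exp v - 1)" by (simp add: mult_ac)
  qed
  finally show ?thesis .
qed

text \<open>This is the converse of the passage from a hinge to the exponential average.  The number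
  \<open>s = r ln (t r / c)\<close>, with \<open>c = exp 1 * b\<close>, is the slope at which Young's inequality
  \<open>t s \<le> A t + A\<^sup>~(s)\<close> reproduces the integral of the hinge exactly.\<close>

lemma hinge_slope_integral_le:
  assumes avg: "exp_average_complementary A (ennreal r) \<le> ennreal b" and r: "0 < r" and b: "0 < b"
    and t: "0 < t"
  shows "(\<integral>\<^sup>+\<tau>\<in>{0<..<t}. ennreal (r * \<tau> - exp 1 * b) / ennreal (\<tau>\<^sup>2) \<partial>lborel)
      \<le> A (ennreal t) / ennreal t"
proof (cases "t \<le> exp 1 * b / r")
  case True
  then show ?thesis using nn_integral_hinge[of r "exp 1 * b" t] r b t by simp
next
  case False
  let ?c = "exp 1 * b"
  define w where "w = t * r / ?c"
  have w: "1 < w" "?c * w = r * t" using False r b by (auto simp: w_def field_simps)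
  define v where "v = ln w"
  have v: "0 < v" "exp v = w" using w by (auto simp: v_def)
  have "ennreal (t * (r * v)) = ennreal t * ennreal (r * v)"
    using t r v by (intro ennreal_mult) auto
  also have "\<dots> \<le> A (ennreal t) + complementary A (ennreal (r * v))"
    by (rule young_inequality[OF t])
  also have "\<dots> \<le> A (ennreal t) + ennreal (?c * (exp v - 1))"
    using b by (intro add_left_mono complementary_le_exp_minus_one[OF avg r _ v(1)]) simp
  also have "?c * (exp v - 1) = r * t - ?c" using v w by (simp add: algebra_simps)
  finally have "ennreal (t * (r * v)) - ennreal (r * t - ?c) \<le> A (ennreal t)"
    by (simp add: ennreal_minus_le_iff add.commute)
  moreover have "0 \<le> r * t - ?c" using False r by (simp add: field_simps)
  ultimately have "ennreal (t * (r * v) - (r * t - ?c)) \<le> A (ennreal t)"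
    by (simp add: ennreal_minus)
  then have "ennreal (t * (r * v) - (r * t - ?c)) / ennreal t \<le> A (ennreal t) / ennreal t"
    by (rule divide_right_mono_ennreal)
  moreover have "ennreal (t * (r * v) - (r * t - ?c)) / ennreal t = ennreal (r * v - r + ?c / t)"
  proof -
    have "(r * v - r + ?c / t) * t = t * (r * v) - (r * t - ?c)" using t by (simp add: field_simps)
    then have "ennreal (t * (r * v) - (r * t - ?c)) = ennreal (r * v - r + ?c / t) * ennreal t"
      using t by (subst ennreal_mult''[symmetric]) auto
    then show ?thesis using t by (simp add: mult_divide_eq_ennreal)
  qed
  ultimately show ?thesis
    using nn_integral_hinge[of r ?c t] r b t False by (simp add: v_def w_def)
qed

section \<open>The weak type estimate for the maximal function\<close>

lemma emeasure_cube:
  assumes "0 \<le> s"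
  shows "emeasure lebesgue (cbox a (a + (\<chi> i. s)) :: (real ^ 'n) set) = ennreal (s ^ CARD('n))"
proof -
  have "cbox a (a + (\<chi> i. s)) \<noteq> ({} :: (real ^ 'n) set)"
    using assms by (auto simp: interval_eq_empty_cart not_less)
  then have "measure lborel (cbox a (a + (\<chi> i. s)) :: (real ^ 'n) set) = s ^ CARD('n)"
    by (simp add: content_cbox_cart)
  moreover have "emeasure lebesgue (cbox a (a + (\<chi> i. s)) :: (real ^ 'n) set)
      = ennreal (measure lborel (cbox a (a + (\<chi> i. s)) :: (real ^ 'n) set))"
    using emeasure_lborel_cbox_finite[of a "a + (\<chi> i. s)"]
    by (simp add: emeasure_eq_ennreal_measure less_top)
  ultimately show ?thesis by simp
qed

lemma cube_subset_cube:
  assumes "s \<le> s'"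
  shows "cbox a (a + (\<chi> i. s)) \<subseteq> (cbox a (a + (\<chi> i. s')) :: (real ^ 'n) set)"
proof
  fix x assume "x \<in> cbox a (a + (\<chi> i. s))"
  then have "a $ i \<le> x $ i" "x $ i \<le> a $ i + s" for i by (auto simp: mem_box_cart)
  then have "a $ i \<le> x $ i \<and> x $ i \<le> a $ i + s'" for i using assms by (smt (verit))
  then show "x \<in> cbox a (a + (\<chi> i. s'))" by (simp add: mem_box_cart)
qed

lemma maximal_function_gt_iff:
  fixes f :: "real ^ 'n \<Rightarrow> real"
  assumes "0 \<le> t"
  shows "ennreal t < maximal_function f x \<longleftrightarrow>
    (\<exists>a s. 0 < s \<and> x \<in> cbox a (a + (\<chi> i. s)) \<and>
      ennreal (t * s ^ CARD('n)) < (\<integral>\<^sup>+y\<in>cbox a (a + (\<chi> i. s)). ennreal \<bar>f y\<bar> \<partial>lebesgue))"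
proof -
  have eq: "ennreal t < I / ennreal (s ^ CARD('n)) \<longleftrightarrow> ennreal (t * s ^ CARD('n)) < I"
    if "0 < s" for I s
  proof -
    define p where "p = s ^ CARD('n)"
    have p: "0 < p" using that by (simp add: p_def)
    show ?thesis unfolding p_def[symmetric]
    proof (cases I)
      case top then show "ennreal t < I / ennreal p \<longleftrightarrow> ennreal (t * p) < I"
        using p by (simp add: ennreal_top_divide)
    next
      case (real r) then show "ennreal t < I / ennreal p \<longleftrightarrow> ennreal (t * p) < I"
        using p assms by (simp add: divide_ennreal ennreal_less_iff field_simps)
    qed
  qed
  have "ennreal t < maximal_function f x \<longleftrightarrow>
    (\<exists>a s. 0 < s \<and> x \<in> cbox a (a + (\<chi> i. s)) \<and>
      ennreal t < (\<integral>\<^sup>+y\<in>cbox a (a + (\<chi> i. s)). ennreal \<bar>f y\<bar> \<partial>lebesgue)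
        / emeasure lebesgue (cbox a (a + (\<chi> i. s))))"
    unfolding maximal_function_def less_SUP_iff is_cube_def by blast
  then show ?thesis using eq by (simp add: emeasure_cube[OF less_imp_le] del: emeasure_completion cong: conj_cong)
qed

text \<open>A slight enlargement of a cube does not decrease the integral and changes the measure only a
  little, so the same cube serves for all points near \<open>x\<close>.\<close>

lemma open_maximal_function_gt:
  fixes f :: "real ^ 'n \<Rightarrow> real"
  shows "open {x. ennreal t < maximal_function f x}"
proof -
  have *: "open {x. ennreal t < maximal_function f x}" if t: "0 \<le> t" for t
  unfolding open_contains_ball
  proof safe
    fix x assume "ennreal t < maximal_function f x"
    then obtain a s where s: "0 < s" "x \<in> cbox a (a + (\<chi> i. s))"
      "ennreal (t * s ^ CARD('n)) < (\<integral>\<^sup>+y\<in>cbox a (a + (\<chi> i. s)). ennreal \<bar>f y\<bar> \<partial>lebesgue)" (is "_ < ?I")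
      using maximal_function_gt_iff[OF t, of f x] by blast
    have "((\<lambda>e. ennreal (t * (s + 2 * e) ^ CARD('n))) \<longlongrightarrow> ennreal (t * (s + 2 * 0) ^ CARD('n))) (at_right 0)"
      by (intro tendsto_intros)
    then have "\<forall>\<^sub>F e in at_right 0. ennreal (t * (s + 2 * e) ^ CARD('n)) < ?I"
      using s(3) by (intro order_tendstoD) auto
    moreover have "\<forall>\<^sub>F e::real in at_right 0. 0 < e"
      by (simp add: eventually_at_right_less)
    ultimately have "\<forall>\<^sub>F e::real in at_right 0. 0 < e \<and> ennreal (t * (s + 2 * e) ^ CARD('n)) < ?I"
      by (rule eventually_conj[rotated])
    then obtain e :: real where e: "0 < e" "ennreal (t * (s + 2 * e) ^ CARD('n)) < ?I"
      using eventually_happens'[OF trivial_limit_at_right_real] by blast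
    let ?b = "a - (\<chi> i. e)" and ?s = "s + 2 * e"
    have "?I \<le> (\<integral>\<^sup>+y\<in>cbox ?b (?b + (\<chi> i. ?s)). ennreal \<bar>f y\<bar> \<partial>lebesgue)"
    proof (intro nn_integral_mono mult_left_mono)
      have "cbox a (a + (\<chi> i. s)) \<subseteq> cbox ?b (?b + (\<chi> i. ?s))"
      proof
        fix z assume z: "z \<in> cbox a (a + (\<chi> i. s))"
        show "z \<in> cbox ?b (?b + (\<chi> i. ?s))"
          unfolding mem_box_cart
        proof
          fix i
          have "a $ i \<le> z $ i" "z $ i \<le> a $ i + s" using z by (auto simp: mem_box_cart)
          then show "?b $ i \<le> z $ i \<and> z $ i \<le> (?b + (\<chi> i. ?s)) $ i" using e by simp
        qed
      qed
      then show "indicator (cbox a (a + (\<chi> i. s))) y \<le> (indicator (cbox ?b (?b + (\<chi> i. ?s))) y :: ennreal)" for y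
        by (auto split: split_indicator)
    qed simp
    then have I: "ennreal (t * ?s ^ CARD('n)) < (\<integral>\<^sup>+y\<in>cbox ?b (?b + (\<chi> i. ?s)). ennreal \<bar>f y\<bar> \<partial>lebesgue)"
      using e(2) by (rule less_le_trans[rotated])
    have "ball x e \<subseteq> {x. ennreal t < maximal_function f x}"
    proof
      fix z assume z: "z \<in> ball x e"
      have "z \<in> cbox ?b (?b + (\<chi> i. ?s))"
        unfolding mem_box_cart
      proof
        fix i
        have "\<bar>(z - x) $ i\<bar> \<le> norm (z - x)" by (rule component_le_norm_cart)
        also have "\<dots> < e" using z by (simp add: dist_norm norm_minus_commute)
        finally have "\<bar>z $ i - x $ i\<bar> < e" by simp
        moreover have "a $ i \<le> x $ i" "x $ i \<le> a $ i + s" using s(2) by (auto simp: mem_box_cart)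
        ultimately show "?b $ i \<le> z $ i \<and> z $ i \<le> (?b + (\<chi> i. ?s)) $ i" by (simp add: abs_less_iff)
      qed
      moreover have "0 < ?s" using s e by simp
      ultimately show "z \<in> {x. ennreal t < maximal_function f x}"
        unfolding mem_Collect_eq maximal_function_gt_iff[OF t] using I by blast
    qed
    then show "\<exists>e>0. ball x e \<subseteq> {x. ennreal t < maximal_function f x}" using e by blast
  qed
  show ?thesis
  proof (cases "0 \<le> t")
    case False
    then have "ennreal t = ennreal 0" by (simp add: ennreal_neg)
    then show ?thesis using *[of 0] by simp
  qed (rule *)
qed

lemma maximal_function_measurable [measurable]:
  "maximal_function f \<in> borel_measurable borel"
proof (rule borel_measurableI_greater)
  fix y :: ennreal
  show "{x \<in> space borel. y < maximal_function f x} \<in> sets borel"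
    by (cases y) (auto simp: open_maximal_function_gt borel_open)
qed

lemma maximal_function_measurable_lebesgue [measurable]:
  "maximal_function f \<in> borel_measurable lebesgue"
  by (rule measurable_completion) (simp add: maximal_function_measurable)

lemma maximal_function_cmult:
  fixes f :: "real ^ 'n \<Rightarrow> real"
  assumes [measurable]: "f \<in> borel_measurable lebesgue" and c: "0 \<le> c"
  shows "maximal_function (\<lambda>x. c * f x) x = ennreal c * maximal_function f x"
proof -
  have "(\<integral>\<^sup>+y\<in>Q. ennreal \<bar>c * f y\<bar> \<partial>lebesgue) / emeasure lebesgue Q
      = ennreal c * ((\<integral>\<^sup>+y\<in>Q. ennreal \<bar>f y\<bar> \<partial>lebesgue) / emeasure lebesgue Q)" if "is_cube Q" for Q :: "(real ^ 'n) set"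
  proof -
    have Q[measurable]: "Q \<in> sets lebesgue" using that by (auto simp: is_cube_def)
    have "(\<integral>\<^sup>+y\<in>Q. ennreal \<bar>c * f y\<bar> \<partial>lebesgue) = (\<integral>\<^sup>+y. ennreal c * (ennreal \<bar>f y\<bar> * indicator Q y) \<partial>lebesgue)"
      using c by (intro nn_integral_cong) (simp add: abs_mult ennreal_mult mult.assoc)
    also have "\<dots> = ennreal c * (\<integral>\<^sup>+y\<in>Q. ennreal \<bar>f y\<bar> \<partial>lebesgue)"
      by (rule nn_integral_cmult) measurable
    finally show ?thesis by (simp add: ennreal_times_divide)
  qed
  then show ?thesis
    unfolding maximal_function_def SUP_mult_left_ennreal by (intro SUP_cong) auto
qed

text \<open>A cube of side \<open>s\<close> lies in the ball of radius \<open>r = n s / 2\<close> around its centre.  The ball of radius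
  \<open>5 r\<close> that comes from Vitali's covering lemma lies in a cube of side \<open>10 r\<close>, whose measure is
  \<open>(5 n)\<^sup>n\<close> times that of the original cube; the factor 2 accounts for the truncation of \<open>f\<close> at \<open>t / 2\<close>.\<close>

definition weak_type_const :: "nat \<Rightarrow> real" where
  "weak_type_const n = 2 * (5 * real n) ^ n"

lemma weak_type_const_pos: "0 < n \<Longrightarrow> 0 < weak_type_const n"
  by (simp add: weak_type_const_def)

text \<open>A cube on which \<open>|f|\<close> has mean larger than \<open>t\<close> still has mean larger than \<open>t / 2\<close> after \<open>f\<close> is
  set to 0 where \<open>|f| \<le> t / 2\<close>.  If the truncated function has a finite integral, such cubes are
  bounded in size, and Vitali's covering lemma selects disjoint ones.\<close>

lemma maximal_function_weak_type:
  fixes f :: "real ^ 'n \<Rightarrow> real"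
  assumes f[measurable]: "f \<in> borel_measurable lebesgue" and t: "0 < t"
  shows "emeasure lebesgue {x. ennreal t < maximal_function f x}
    \<le> ennreal (weak_type_const CARD('n) / t) * (\<integral>\<^sup>+x\<in>{x. t / 2 < \<bar>f x\<bar>}. ennreal \<bar>f x\<bar> \<partial>lebesgue)"
proof -
  let ?n = "CARD('n)"
  define g where "g x = ennreal \<bar>f x\<bar> * indicator {x. t / 2 < \<bar>f x\<bar>} x" for x
  have g[measurable]: "g \<in> borel_measurable lebesgue" unfolding g_def by measurable
  define J where "J = (\<integral>\<^sup>+x. g x \<partial>lebesgue)"
  have n: "0 < ?n" by simp
  have c: "0 < weak_type_const ?n / t" using t n by (simp add: weak_type_const_def)
  let ?Q = "\<lambda>(a, s). cbox a (a + (\<chi> i. s)) :: (real ^ 'n) set"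
  show ?thesis
  proof (cases J)
    case top
    have "ennreal (weak_type_const ?n / t) \<noteq> 0" using c by (simp only: ennreal_eq_0_iff not_le)
    then have "ennreal (weak_type_const ?n / t) * J = top"
      unfolding top by (rule ennreal_top_mult_left)
    then show ?thesis unfolding J_def g_def by (metis top_greatest)
  next
    case (real j)
    define K where "K = {(a, s). 0 < s \<and> ennreal (t / 2 * s ^ ?n) < (\<integral>\<^sup>+y\<in>?Q (a, s). g y \<partial>lebesgue)}"
    \<comment> \<open>The covering lemma needs balls: each cube is replaced by a ball that contains it.\<close>
    define ctr where "ctr = (\<lambda>(a :: real ^ 'n, s :: real). a + (\<chi> i. s / 2))"
    define rad where "rad = (\<lambda>(a :: real ^ 'n, s :: real). real ?n * s / 2)"
    have sub: "?Q p \<subseteq> cball (ctr p) (rad p)" if "p \<in> K" for p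
    proof
      fix z assume "z \<in> ?Q p"
      then obtain a s where p: "p = (a, s)" and z: "z \<in> cbox a (a + (\<chi> i. s))" by (cases p) auto
      have "norm (z - ctr p) \<le> (\<Sum>i\<in>UNIV. \<bar>(z - ctr p) $ i\<bar>)" by (rule norm_le_l1_cart)
      also have "\<dots> \<le> (\<Sum>i\<in>(UNIV::'n set). s / 2)"
      proof (rule sum_mono)
        fix i
        have "a $ i \<le> z $ i" "z $ i \<le> a $ i + s" using z by (auto simp: mem_box_cart)
        then show "\<bar>(z - ctr p) $ i\<bar> \<le> s / 2" by (simp add: p ctr_def abs_le_iff field_simps)
      qed
      also have "\<dots> = rad p" by (simp add: p rad_def)
      finally show "z \<in> cball (ctr p) (rad p)" by (simp add: dist_norm norm_minus_commute)
    qed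
    have cover: "{x. ennreal t < maximal_function f x} \<subseteq> (\<Union>p\<in>K. cball (ctr p) (rad p))"
    proof
      fix x assume "x \<in> {x. ennreal t < maximal_function f x}"
      then obtain a s where s: "0 < s" "x \<in> cbox a (a + (\<chi> i. s))"
        and I: "ennreal (t * s ^ ?n) < (\<integral>\<^sup>+y\<in>cbox a (a + (\<chi> i. s)). ennreal \<bar>f y\<bar> \<partial>lebesgue)"
        using maximal_function_gt_iff[of t f x] t by auto
      have "(\<integral>\<^sup>+y\<in>cbox a (a + (\<chi> i. s)). ennreal \<bar>f y\<bar> \<partial>lebesgue)
          \<le> (\<integral>\<^sup>+y. g y * indicator (cbox a (a + (\<chi> i. s))) y
               + ennreal (t / 2) * indicator (cbox a (a + (\<chi> i. s))) y \<partial>lebesgue)"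
        by (intro nn_integral_mono) (auto simp: g_def split: split_indicator)
      also have "\<dots> = (\<integral>\<^sup>+y\<in>cbox a (a + (\<chi> i. s)). g y \<partial>lebesgue)
          + (\<integral>\<^sup>+y. ennreal (t / 2) * indicator (cbox a (a + (\<chi> i. s))) y \<partial>lebesgue)"
        by (rule nn_integral_add) (intro borel_measurable_times_ennreal borel_measurable_indicator g borel_measurable_const; simp)+
      also have "(\<integral>\<^sup>+y. ennreal (t / 2) * indicator (cbox a (a + (\<chi> i. s))) y \<partial>lebesgue)
          = ennreal (t / 2) * ennreal (s ^ ?n)"
        using s by (subst nn_integral_cmult_indicator) (simp_all only: emeasure_cube[OF less_imp_le], simp)
      also have "\<dots> = ennreal (t / 2 * s ^ ?n)" using s t by (intro ennreal_mult[symmetric]) auto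
      finally have le: "(\<integral>\<^sup>+y\<in>cbox a (a + (\<chi> i. s)). ennreal \<bar>f y\<bar> \<partial>lebesgue)
          \<le> (\<integral>\<^sup>+y\<in>cbox a (a + (\<chi> i. s)). g y \<partial>lebesgue) + ennreal (t / 2 * s ^ ?n)" .
      have "ennreal (t / 2 * s ^ ?n) + ennreal (t / 2 * s ^ ?n) = ennreal (t * s ^ ?n)"
        using s t by (subst ennreal_plus[symmetric]) auto
      with less_le_trans[OF I le] have "ennreal (t / 2 * s ^ ?n) + ennreal (t / 2 * s ^ ?n)
          < ennreal (t / 2 * s ^ ?n) + (\<integral>\<^sup>+y\<in>cbox a (a + (\<chi> i. s)). g y \<partial>lebesgue)"
        by (simp only: add.commute)
      then have "ennreal (t / 2 * s ^ ?n) < (\<integral>\<^sup>+y\<in>cbox a (a + (\<chi> i. s)). g y \<partial>lebesgue)"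
        unfolding ennreal_add_left_cancel_less by (rule conjunct2)
      then have "(a, s) \<in> K" using s by (simp add: K_def)
      then show "x \<in> (\<Union>p\<in>K. cball (ctr p) (rad p))" using sub[of "(a, s)"] s by blast
    qed
    have rad: "0 < rad p \<and> rad p \<le> real ?n * max 1 (2 * j / t) / 2" if "p \<in> K" for p
    proof -
      obtain a s where p: "p = (a, s)" by (cases p)
      have s: "0 < s" and I: "ennreal (t / 2 * s ^ ?n) < (\<integral>\<^sup>+y\<in>?Q (a, s). g y \<partial>lebesgue)"
        using that by (auto simp: K_def p)
      have "(\<integral>\<^sup>+y\<in>?Q (a, s). g y \<partial>lebesgue) \<le> J"
        unfolding J_def by (intro nn_integral_mono) (auto split: split_indicator)
      with I real have "ennreal (t / 2 * s ^ ?n) < ennreal j" by simp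
      then have "t / 2 * s ^ ?n < j" using s t by (simp add: ennreal_less_iff)
      then have sn: "s ^ ?n \<le> 2 * j / t" using t by (simp add: field_simps)
      have "s \<le> max 1 (2 * j / t)"
      proof (cases "s \<le> 1")
        case False
        then have "s ^ 1 \<le> s ^ ?n" using n by (intro power_increasing) auto
        then show ?thesis using sn by simp
      qed auto
      then have "real ?n * s \<le> real ?n * max 1 (2 * j / t)" by (intro mult_left_mono) auto
      then show ?thesis using s n by (simp add: p rad_def)
    qed
    obtain C where C: "countable C" "C \<subseteq> K"
      and disj: "pairwise (\<lambda>i j. disjnt (cball (ctr i) (rad i)) (cball (ctr j) (rad j))) C"
      and CS: "{x. ennreal t < maximal_function f x} \<subseteq> (\<Union>i\<in>C. cball (ctr i) (5 * rad i))"
      by (rule Vitali_covering_lemma_cballs[OF cover rad]) (assumption, rule that)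
    have "emeasure lebesgue {x. ennreal t < maximal_function f x}
        = (\<integral>\<^sup>+x. indicator {x. ennreal t < maximal_function f x} x \<partial>lebesgue)" by simp
    also have "\<dots> \<le> (\<integral>\<^sup>+x. \<integral>\<^sup>+p. indicator (cball (ctr p) (5 * rad p)) x \<partial>count_space C \<partial>lebesgue)"
    proof (rule nn_integral_mono)
      fix x
      show "indicator {x. ennreal t < maximal_function f x} x
          \<le> (\<integral>\<^sup>+p. indicator (cball (ctr p) (5 * rad p)) x \<partial>count_space C)"
      proof (cases "ennreal t < maximal_function f x")
        case True
        then obtain p where p: "p \<in> C" "x \<in> cball (ctr p) (5 * rad p)" using CS by blast
        have "(\<integral>\<^sup>+p. indicator (cball (ctr p) (5 * rad p)) x \<partial>count_space C)
            \<ge> (\<integral>\<^sup>+q. indicator {p} q \<partial>count_space C)"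
          using p by (intro nn_integral_mono) (auto split: split_indicator)
        moreover have "(\<integral>\<^sup>+q. indicator {p} q \<partial>count_space C) = (1::ennreal)"
          using p by (subst nn_integral_indicator) auto
        ultimately show ?thesis using True by simp
      qed simp
    qed
    also have "\<dots> = (\<integral>\<^sup>+p. \<integral>\<^sup>+x. indicator (cball (ctr p) (5 * rad p)) x \<partial>lebesgue \<partial>count_space C)"
      using C(1) by (rule nn_integral_count_space_nn_integral) (intro borel_measurable_indicator; simp)
    also have "\<dots> \<le> (\<integral>\<^sup>+p. ennreal (weak_type_const ?n / t) * (\<integral>\<^sup>+x\<in>?Q p. g x \<partial>lebesgue) \<partial>count_space C)"
    proof (rule nn_integral_mono)
      fix p assume "p \<in> space (count_space C)"
      then have "p \<in> K" using C by auto
      obtain a s where p: "p = (a, s)" by (cases p)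
      have s: "0 < s" and I: "ennreal (t / 2 * s ^ ?n) < (\<integral>\<^sup>+y\<in>?Q (a, s). g y \<partial>lebesgue)"
        using \<open>p \<in> K\<close> by (auto simp: K_def p)
      let ?r = "5 * rad p"
      have "cball (ctr p) ?r \<subseteq> cbox (ctr p - (\<chi> i. ?r)) (ctr p - (\<chi> i. ?r) + (\<chi> i. 2 * ?r))"
      proof
        fix z assume z: "z \<in> cball (ctr p) ?r"
        show "z \<in> cbox (ctr p - (\<chi> i. ?r)) (ctr p - (\<chi> i. ?r) + (\<chi> i. 2 * ?r))"
          unfolding mem_box_cart
        proof
          fix i
          have "\<bar>(z - ctr p) $ i\<bar> \<le> norm (z - ctr p)" by (rule component_le_norm_cart)
          also have "\<dots> \<le> ?r" using z by (simp add: dist_norm norm_minus_commute)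
          finally have "\<bar>z $ i - ctr p $ i\<bar> \<le> ?r" by simp
          then show "(ctr p - (\<chi> i. ?r)) $ i \<le> z $ i \<and> z $ i \<le> (ctr p - (\<chi> i. ?r) + (\<chi> i. 2 * ?r)) $ i"
            by (simp add: abs_le_iff)
        qed
      qed
      then have "emeasure lebesgue (cball (ctr p) ?r)
          \<le> emeasure lebesgue (cbox (ctr p - (\<chi> i. ?r)) (ctr p - (\<chi> i. ?r) + (\<chi> i. 2 * ?r)))"
        by (rule emeasure_mono) simp
      also have "\<dots> = ennreal ((2 * ?r) ^ ?n)"
        using rad[OF \<open>p \<in> K\<close>] by (intro emeasure_cube) simp
      also have "(2 * ?r) ^ ?n = (weak_type_const ?n / t) * (t / 2 * s ^ ?n)"
        using t by (simp add: p rad_def weak_type_const_def power_mult_distrib)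
      also have "ennreal \<dots> = ennreal (weak_type_const ?n / t) * ennreal (t / 2 * s ^ ?n)"
        using c s t by (intro ennreal_mult) auto
      also have "\<dots> \<le> ennreal (weak_type_const ?n / t) * (\<integral>\<^sup>+x\<in>?Q p. g x \<partial>lebesgue)"
        using I by (intro mult_left_mono) (auto simp: p)
      finally show "(\<integral>\<^sup>+x. indicator (cball (ctr p) ?r) x \<partial>lebesgue)
          \<le> ennreal (weak_type_const ?n / t) * (\<integral>\<^sup>+x\<in>?Q p. g x \<partial>lebesgue)" by simp
    qed
    also have "\<dots> = ennreal (weak_type_const ?n / t) * (\<integral>\<^sup>+p. (\<integral>\<^sup>+x\<in>?Q p. g x \<partial>lebesgue) \<partial>count_space C)"
      by (rule nn_integral_cmult) simp
    also have "(\<integral>\<^sup>+p. (\<integral>\<^sup>+x\<in>?Q p. g x \<partial>lebesgue) \<partial>count_space C)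
        = (\<integral>\<^sup>+x. \<integral>\<^sup>+p. g x * indicator (?Q p) x \<partial>count_space C \<partial>lebesgue)"
      using C(1)
      by (intro nn_integral_count_space_nn_integral[symmetric] borel_measurable_times_ennreal
          borel_measurable_indicator g) (auto split: prod.splits)
    also have "\<dots> \<le> J"
      unfolding J_def
    proof (rule nn_integral_mono)
      fix x
      show "(\<integral>\<^sup>+p. g x * indicator (?Q p) x \<partial>count_space C) \<le> g x"
      proof (cases "\<exists>p\<in>C. x \<in> ?Q p")
        case True
        then obtain p where p: "p \<in> C" "x \<in> ?Q p" by blast
        have "indicator (?Q q) x \<le> (indicator {p} q :: ennreal)" if q: "q \<in> C" for q
        proof (cases "q = p")
          case False
          have "x \<notin> ?Q q"
          proof
            assume "x \<in> ?Q q"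
            then have "x \<in> cball (ctr q) (rad q)" "x \<in> cball (ctr p) (rad p)"
              using sub p q C by blast+
            moreover have "disjnt (cball (ctr q) (rad q)) (cball (ctr p) (rad p))"
              using disj False p(1) q by (auto simp only: pairwise_def)
            ultimately show False unfolding disjnt_def by blast
          qed
          then show ?thesis by simp
        qed (simp add: indicator_def)
        then have "(\<integral>\<^sup>+p. g x * indicator (?Q p) x \<partial>count_space C)
            \<le> (\<integral>\<^sup>+q. g x * indicator {p} q \<partial>count_space C)"
          by (intro nn_integral_mono mult_left_mono) auto
        also have "\<dots> = g x" using p by (subst nn_integral_cmult_indicator) auto
        finally show ?thesis .
      next
        case False
        then have "(\<integral>\<^sup>+p. g x * indicator (?Q p) x \<partial>count_space C) = (\<integral>\<^sup>+p. 0 \<partial>count_space C)"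
          by (intro nn_integral_cong) auto
        then show ?thesis by simp
      qed
    qed
    finally show ?thesis unfolding J_def g_def by (simp add: mult_left_mono)
  qed
qed

section \<open>Luxemburg norms and Orlicz spaces\<close>

lemma divide_ennreal_antimono:
  assumes "0 < l" "l \<le> l'"
  shows "g / ennreal l' \<le> g / ennreal l"
  using assms unfolding divide_ennreal_def
  by (intro mult_left_mono) (auto simp: inverse_ennreal intro!: ennreal_leI)

lemma luxemburg_norm_leI:
  assumes "0 < l" "(\<integral>\<^sup>+x. A (g x / ennreal l) \<partial>lebesgue) \<le> 1"
  shows "luxemburg_norm A g \<le> ennreal l"
  unfolding luxemburg_norm_def using assms by (intro INF_lower) simp

lemma luxemburg_norm_lessD:
  assumes "young_function A" "luxemburg_norm A g < ennreal l"
  shows "(\<integral>\<^sup>+x. A (g x / ennreal l) \<partial>lebesgue) \<le> 1"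
proof -
  obtain l' where l': "0 < l'" "(\<integral>\<^sup>+x. A (g x / ennreal l') \<partial>lebesgue) \<le> 1" "ennreal l' < ennreal l"
    using assms(2) unfolding luxemburg_norm_def INF_less_iff by auto
  have "l' \<le> l" using l' by (simp add: ennreal_less_iff)
  then have "(\<integral>\<^sup>+x. A (g x / ennreal l) \<partial>lebesgue) \<le> (\<integral>\<^sup>+x. A (g x / ennreal l') \<partial>lebesgue)"
    using l'(1) by (intro nn_integral_mono young_function_mono[OF assms(1)] divide_ennreal_antimono)
  then show ?thesis using l'(2) by (rule order_trans)
qed

text \<open>Bounds by a multiple of a norm are proved by testing on the numbers \<open>l\<close> that occur in its definition.\<close>

lemma le_mult_luxemburg_norm:
  assumes "0 < C"
    and "\<And>l. 0 < l \<Longrightarrow> (\<integral>\<^sup>+x. A (g x / ennreal l) \<partial>lebesgue) \<le> 1 \<Longrightarrow> N \<le> ennreal (C * l)"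
  shows "N \<le> ennreal C * luxemburg_norm A g"
proof -
  have "ennreal (1 / C) * N \<le> luxemburg_norm A g"
    unfolding luxemburg_norm_def
  proof (rule INF_greatest)
    fix l assume "l \<in> {l::real. 0 < l \<and> (\<integral>\<^sup>+x. A (g x / ennreal l) \<partial>lebesgue) \<le> 1}"
    then have "ennreal (1 / C) * N \<le> ennreal (1 / C) * ennreal (C * l)" "0 < l"
      using assms(2) by (auto intro: mult_left_mono)
    then show "ennreal (1 / C) * N \<le> ennreal l" using assms(1) by (simp flip: ennreal_mult)
  qed
  then have "ennreal C * (ennreal (1 / C) * N) \<le> ennreal C * luxemburg_norm A g"
    by (rule mult_left_mono) simp
  also have "ennreal C * (ennreal (1 / C) * N) = N"
    using assms(1) by (simp flip: ennreal_mult mult.assoc)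
  finally show ?thesis .
qed

lemma luxemburg_norm_mono:
  assumes "0 < C" "\<And>x. D x \<le> B (ennreal C * x)"
  shows "luxemburg_norm D g \<le> ennreal C * luxemburg_norm B g"
proof (rule le_mult_luxemburg_norm[OF assms(1)])
  fix l :: real assume l: "0 < l" "(\<integral>\<^sup>+x. B (g x / ennreal l) \<partial>lebesgue) \<le> 1"
  show "luxemburg_norm D g \<le> ennreal (C * l)"
  proof (rule luxemburg_norm_leI)
    have "(\<integral>\<^sup>+x. D (g x / ennreal (C * l)) \<partial>lebesgue) \<le> (\<integral>\<^sup>+x. B (g x / ennreal l) \<partial>lebesgue)"
    proof (rule nn_integral_mono)
      fix x
      have "ennreal C * (g x / ennreal (C * l)) = ennreal C * ennreal (inverse (C * l)) * g x"
        using assms(1) l(1) unfolding divide_ennreal_def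
        by (subst inverse_ennreal) (auto simp: mult_ac)
      also have "ennreal C * ennreal (inverse (C * l)) = ennreal (C * inverse (C * l))"
        using assms(1) l(1) by (intro ennreal_mult[symmetric]) auto
      also have "C * inverse (C * l) = inverse l" using assms(1) l(1) by (simp add: field_simps)
      also have "ennreal (inverse l) * g x = g x / ennreal l"
        using l(1) unfolding divide_ennreal_def by (simp add: inverse_ennreal mult.commute)
      finally show "D (g x / ennreal (C * l)) \<le> B (g x / ennreal l)"
        using assms(2)[of "g x / ennreal (C * l)"] by simp
    qed
    then show "(\<integral>\<^sup>+x. D (g x / ennreal (C * l)) \<partial>lebesgue) \<le> 1" using l(2) by (rule order_trans)
  qed (use assms l in simp)
qed

lemma orlicz_space_mono:
  assumes "0 < C" "\<And>x. D x \<le> B (ennreal C * x)"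
  shows "orlicz_space B \<subseteq> orlicz_space D"
proof
  fix f assume f: "f \<in> orlicz_space B"
  have "luxemburg_norm D (\<lambda>x. ennreal \<bar>f x\<bar>) \<le> ennreal C * luxemburg_norm B (\<lambda>x. ennreal \<bar>f x\<bar>)"
    by (rule luxemburg_norm_mono[where D = D and B = B and C = C, OF assms])
  also have "\<dots> < \<infinity>" using f by (auto simp: orlicz_space_def ennreal_mult_less_top)
  finally show "f \<in> orlicz_space D" using f by (simp add: orlicz_space_def)
qed

lemma suminf_half_powers: "(\<Sum>k. ennreal ((1/2) ^ Suc k)) = 1"
proof -
  have "(\<lambda>k. ennreal ((1/2) ^ Suc k)) sums ennreal 1"
    using power_half_series by (subst sums_ennreal) auto
  then show ?thesis by (simp only: sums_unique[symmetric] ennreal_1)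
qed

text \<open>The sets are the shells between consecutive cubes of an increasing sequence with a common corner.\<close>

lemma disjoint_sets_with_measures:
  fixes m :: "nat \<Rightarrow> real"
  assumes m: "\<And>k. 0 \<le> m k"
  obtains E :: "nat \<Rightarrow> (real ^ 'n) set"
  where "disjoint_family E" "\<And>k. E k \<in> sets lebesgue" "\<And>k. emeasure lebesgue (E k) = ennreal (m k)"
proof -
  let ?n = "CARD('n)"
  define v where "v k = (\<Sum>j<k. m j)" for k
  have v: "0 \<le> v k" "v k \<le> v (Suc k)" for k using m by (auto simp: v_def intro: sum_nonneg)
  define Q :: "nat \<Rightarrow> (real ^ 'n) set" where "Q k = cbox 0 (0 + (\<chi> i. root ?n (v k)))" for k
  have Q: "Q k \<in> sets lebesgue" "emeasure lebesgue (Q k) = ennreal (v k)" for k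
    unfolding Q_def using v by (simp, subst emeasure_cube) (auto simp: real_root_pow_pos2)
  have mono: "Q k \<subseteq> Q (Suc k)" for k
    unfolding Q_def using v by (intro cube_subset_cube) simp
  show thesis
  proof (rule that[of "\<lambda>k. Q (Suc k) - Q k"])
    show "disjoint_family (\<lambda>k. Q (Suc k) - Q k)" by (rule disjoint_family_Suc) (rule mono)
    show "Q (Suc k) - Q k \<in> sets lebesgue" for k using Q by (intro sets.Diff)
    show "emeasure lebesgue (Q (Suc k) - Q k) = ennreal (m k)" for k
    proof -
      have "emeasure lebesgue (Q (Suc k) - Q k) = ennreal (v (Suc k)) - ennreal (v k)"
        using Q mono by (subst emeasure_Diff) (auto simp del: emeasure_completion)
      also have "\<dots> = ennreal (m k)" using v m by (simp add: ennreal_minus) (simp add: v_def)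
      finally show ?thesis .
    qed
  qed
qed

text \<open>If no \<open>k\<close> works, there are points \<open>t k\<close> with \<open>B (4\<^sup>k t k) < D (t k)\<close>.  The function that equals
  \<open>4\<^sup>k t k\<close> on disjoint sets of suitable measure has \<open>B\<close>-modular at most 1, whereas by convexity
  the \<open>D\<close>-modular of each of its positive multiples exceeds 1.\<close>

lemma orlicz_space_subset_imp_dominated:
  assumes B: "young_function B" and D: "young_function D"
    and sub: "(orlicz_space B :: (real ^ 'n \<Rightarrow> real) set) \<subseteq> orlicz_space D"
  shows "\<exists>k::nat. \<forall>t>0. D (ennreal t) \<le> B (ennreal (4 ^ k * t))"
proof (rule ccontr)
  assume "\<not> ?thesis"
  then have "\<forall>k. \<exists>t>0. B (ennreal (4 ^ k * t)) < D (ennreal t)" by (auto simp: not_le)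
  then obtain t where t: "\<And>k. 0 < t k" "\<And>k. B (ennreal (4 ^ k * t k)) < D (ennreal (t k))" by metis
  \<comment> \<open>A positive number between the two values is needed as a divisor, since \<open>B\<close> may vanish and \<open>D\<close> may be infinite there.\<close>
  have "\<exists>\<beta>>0. B (ennreal (4 ^ k * t k)) \<le> ennreal \<beta> \<and> ennreal \<beta> \<le> D (ennreal (t k))" for k
  proof -
    obtain y where y: "B (ennreal (4 ^ k * t k)) < y" "y < D (ennreal (t k))" using dense[OF t(2)] by blast
    have "0 < y" using y(1) by (rule le_less_trans[OF zero_le])
    then show ?thesis using y by (intro exI[of _ "enn2real y"]) (cases y, auto simp: less_imp_le)
  qed
  then obtain \<beta> where \<beta>: "\<And>k. 0 < \<beta> k" "\<And>k. B (ennreal (4 ^ k * t k)) \<le> ennreal (\<beta> k)"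
    "\<And>k. ennreal (\<beta> k) \<le> D (ennreal (t k))" by metis
  obtain E :: "nat \<Rightarrow> (real ^ 'n) set" where disj: "disjoint_family E" and E[measurable]: "\<And>k. E k \<in> sets lebesgue"
    and Em: "\<And>k. emeasure lebesgue (E k) = ennreal ((1/2) ^ Suc k / \<beta> k)"
    using disjoint_sets_with_measures[of "\<lambda>k. (1/2) ^ Suc k / \<beta> k"] \<beta>(1) by (metis divide_nonneg_pos zero_le_power half_gt_zero_iff less_imp_le zero_less_one)
  define F where "F x = (\<Sum>k. ennreal (4 ^ k * t k) * indicator (E k) x)" for x
  have F_in: "F x = ennreal (4 ^ k * t k)" if "x \<in> E k" for k x
    unfolding F_def by (rule suminf_cmult_indicator[OF disj that])
  have F_out: "F x = 0" if "\<And>k. x \<notin> E k" for x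
    unfolding F_def using that by simp
  have F_meas[measurable]: "F \<in> borel_measurable lebesgue" unfolding F_def by measurable
  define f where "f x = enn2real (F x)" for x
  have f[measurable]: "f \<in> borel_measurable lebesgue" unfolding f_def by measurable
  have fF: "ennreal \<bar>f x\<bar> = F x" for x
  proof (cases "\<exists>k. x \<in> E k")
    case True
    then obtain k where "x \<in> E k" by blast
    then show ?thesis using F_in t(1)[of k] by (simp add: f_def less_imp_le)
  next
    case False
    then show ?thesis using F_out by (simp add: f_def)
  qed
  have "luxemburg_norm B (\<lambda>x. ennreal \<bar>f x\<bar>) \<le> ennreal 1"
  proof (rule luxemburg_norm_leI)
    have "(\<integral>\<^sup>+x. B (ennreal \<bar>f x\<bar> / ennreal 1) \<partial>lebesgue)
        = (\<integral>\<^sup>+x. (\<Sum>k. B (ennreal (4 ^ k * t k)) * indicator (E k) x) \<partial>lebesgue)"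
    proof (rule nn_integral_cong)
      fix x
      have "B (F x) = (\<Sum>k. B (ennreal (4 ^ k * t k)) * indicator (E k) x)"
      proof (cases "\<exists>k. x \<in> E k")
        case True
        then obtain k where k: "x \<in> E k" by blast
        show ?thesis unfolding F_in[OF k] by (rule suminf_cmult_indicator[OF disj k, symmetric])
      next
        case False
        then show ?thesis using F_out young_function_0[OF B] by simp
      qed
      then show "B (ennreal \<bar>f x\<bar> / ennreal 1) = (\<Sum>k. B (ennreal (4 ^ k * t k)) * indicator (E k) x)"
        by (simp add: fF divide_ennreal_def)
    qed
    also have "\<dots> = (\<Sum>k. \<integral>\<^sup>+x. B (ennreal (4 ^ k * t k)) * indicator (E k) x \<partial>lebesgue)"
      by (rule nn_integral_suminf) measurable
    also have "\<dots> = (\<Sum>k. B (ennreal (4 ^ k * t k)) * emeasure lebesgue (E k))"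
      by (intro suminf_cong nn_integral_cmult_indicator E)
    also have "\<dots> \<le> (\<Sum>k. ennreal ((1/2) ^ Suc k))"
    proof (rule suminf_le)
      fix k
      have "B (ennreal (4 ^ k * t k)) * emeasure lebesgue (E k) \<le> ennreal (\<beta> k) * ennreal ((1/2) ^ Suc k / \<beta> k)"
        unfolding Em by (intro mult_right_mono \<beta>) simp
      also have "\<dots> = ennreal ((1/2) ^ Suc k)"
        using \<beta>(1)[of k] by (subst ennreal_mult[symmetric]) auto
      finally show "B (ennreal (4 ^ k * t k)) * emeasure lebesgue (E k) \<le> ennreal ((1/2) ^ Suc k)" .
    qed auto
    also have "\<dots> = 1" by (rule suminf_half_powers)
    finally show "(\<integral>\<^sup>+x. B (ennreal \<bar>f x\<bar> / ennreal 1) \<partial>lebesgue) \<le> 1" .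
  qed simp
  then have "f \<in> orlicz_space B"
    unfolding orlicz_space_def by (auto simp: less_top[symmetric] top_unique)
  then have "f \<in> orlicz_space D" using sub by blast
  then have "luxemburg_norm D (\<lambda>x. ennreal \<bar>f x\<bar>) < \<infinity>" by (simp add: orlicz_space_def)
  then obtain l0 where l0: "luxemburg_norm D (\<lambda>x. ennreal \<bar>f x\<bar>) = ennreal l0" "0 \<le> l0"
    by (auto simp: less_top_ennreal)
  define l where "l = l0 + 1"
  have l: "1 \<le> l" using l0 by (simp add: l_def)
  have int: "(\<integral>\<^sup>+x. D (F x / ennreal l) \<partial>lebesgue) \<le> 1"
    using luxemburg_norm_lessD[OF D, of "\<lambda>x. ennreal \<bar>f x\<bar>" l] l0
    by (simp add: fF l_def ennreal_less_iff del: ennreal_plus)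
  obtain k where k: "2 * l < 2 ^ k" using real_arch_pow[of 2 "2 * l"] by auto
  have "(2::real) ^ k \<le> 4 ^ k" by (rule power_mono) auto
  then have kl: "1 \<le> 4 ^ k / l" using k l by (simp add: field_simps)
  have "1 < 4 ^ k / l * (1/2) ^ Suc k"
  proof -
    have "(4::real) ^ k = 2 ^ k * 2 ^ k" by (simp flip: power_mult_distrib)
    then show ?thesis using k l by (simp add: power_divide field_simps)
  qed
  then have "1 < ennreal (4 ^ k / l * (1/2) ^ Suc k)" by simp
  also have "4 ^ k / l * (1/2) ^ Suc k = (4 ^ k / l * \<beta> k) * ((1/2) ^ Suc k / \<beta> k)"
    using \<beta>(1)[of k] by simp
  also have "ennreal \<dots> = (ennreal (4 ^ k / l) * ennreal (\<beta> k)) * emeasure lebesgue (E k)"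
    unfolding Em using \<beta>(1)[of k] l by (simp add: less_imp_le flip: ennreal_mult)
  also have "\<dots> \<le> D (ennreal (4 ^ k * t k / l)) * emeasure lebesgue (E k)"
  proof (rule mult_right_mono)
    have "ennreal (4 ^ k / l) * ennreal (\<beta> k) \<le> ennreal (4 ^ k / l) * D (ennreal (t k))"
      by (intro mult_left_mono \<beta>) simp
    also have "\<dots> \<le> D (ennreal (4 ^ k / l) * ennreal (t k))" by (rule young_function_scale_ge[OF D kl])
    also have "ennreal (4 ^ k / l) * ennreal (t k) = ennreal (4 ^ k * t k / l)"
      using l t(1)[of k] by (simp flip: ennreal_mult)
    finally show "ennreal (4 ^ k / l) * ennreal (\<beta> k) \<le> D (ennreal (4 ^ k * t k / l))" .
  qed simp
  also have "\<dots> = (\<integral>\<^sup>+x. D (ennreal (4 ^ k * t k / l)) * indicator (E k) x \<partial>lebesgue)"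
    by (rule nn_integral_cmult_indicator[symmetric]) (rule E)
  also have "\<dots> \<le> (\<integral>\<^sup>+x. D (F x / ennreal l) \<partial>lebesgue)"
    using F_in l t(1)[of k] by (intro nn_integral_mono) (auto split: split_indicator simp: divide_ennreal)
  also have "\<dots> \<le> 1" by (rule int)
  finally show False by simp
qed

section \<open>Boundedness of the maximal operator as a scalar condition\<close>

lemma sigma_finite_lebesgue: "sigma_finite_measure (lebesgue :: 'a::euclidean_space measure)"
proof -
  obtain F :: "'a set set" where F: "countable F" "F \<subseteq> sets lborel" "\<Union>F = space lborel"
    "\<forall>a\<in>F. emeasure lborel a \<noteq> \<infinity>"
    using lborel.sigma_finite_countable by blast
  show ?thesis
    by standard (use F in \<open>auto intro!: exI[of _ F]\<close>)
qed

lemma Fubini_lborel_lebesgue: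
  fixes f :: "real \<times> 'a::euclidean_space \<Rightarrow> ennreal"
  assumes "f \<in> borel_measurable (lborel \<Otimes>\<^sub>M lebesgue)"
  shows "(\<integral>\<^sup>+x. \<integral>\<^sup>+\<sigma>. f (\<sigma>, x) \<partial>lborel \<partial>lebesgue) = (\<integral>\<^sup>+\<sigma>. \<integral>\<^sup>+x. f (\<sigma>, x) \<partial>lebesgue \<partial>lborel)"
proof -
  interpret L: sigma_finite_measure "lebesgue :: 'a measure" by (rule sigma_finite_lebesgue)
  interpret pair_sigma_finite "lborel :: real measure" "lebesgue :: 'a measure" ..
  show ?thesis by (rule Fubini[OF assms])
qed

text \<open>The scalar condition that characterizes boundedness of the maximal operator from \<open>L\<^sup>A\<close> to \<open>L\<^sup>D\<close>.\<close>

definition slope_integral_bound :: "(ennreal \<Rightarrow> ennreal) \<Rightarrow> (ennreal \<Rightarrow> ennreal) \<Rightarrow> real \<Rightarrow> bool" where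
  "slope_integral_bound A D K \<longleftrightarrow> (\<forall>t::real. 0 < t \<longrightarrow>
     (\<integral>\<^sup>+\<tau>\<in>{0<..<t}. D (ennreal \<tau>) / ennreal (\<tau>\<^sup>2) \<partial>lborel) \<le> A (ennreal (K * t)) / ennreal t)"

text \<open>Fubini is applied twice: first to write the modular of \<open>M f\<close> as an integral of
  \<open>D \<sigma> / \<sigma> * |{2 M f > \<sigma>}|\<close> over \<open>\<sigma>\<close>, and, after the weak type estimate, to bring the integral
  over \<open>\<sigma>\<close> inside, where it becomes \<open>\<integral>\<^sub>0\<^bsup>4|f|\<^esup> D(\<sigma>) / \<sigma>\<^sup>2 d\<sigma>\<close>.\<close>

lemma maximal_function_modular_bound:
  fixes f :: "real ^ 'n \<Rightarrow> real"
  assumes A: "young_function A" and D: "young_function D" and f[measurable]: "f \<in> borel_measurable lebesgue"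
    and IC: "slope_integral_bound A D K"
  shows "(\<integral>\<^sup>+x. D (maximal_function f x) \<partial>lebesgue)
    \<le> ennreal (2 * weak_type_const CARD('n)) * (\<integral>\<^sup>+x. A (ennreal (4 * K * \<bar>f x\<bar>)) \<partial>lebesgue)"
proof -
  define w where "w = weak_type_const CARD('n)"
  have w: "0 < w" unfolding w_def by (rule weak_type_const_pos) simp
  note [measurable] = young_function_measurable[OF A] young_function_measurable[OF D]
  have "(\<integral>\<^sup>+x. D (maximal_function f x) \<partial>lebesgue)
      \<le> (\<integral>\<^sup>+x. \<integral>\<^sup>+\<sigma>. (if 0 < \<sigma> \<and> ennreal \<sigma> < 2 * maximal_function f x then D (ennreal \<sigma>) / ennreal \<sigma> else 0)
            \<partial>lborel \<partial>lebesgue)"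
  proof (rule nn_integral_mono)
    fix x
    have "D (maximal_function f x)
      \<le> (\<integral>\<^sup>+\<sigma>\<in>{\<sigma>. 0 < \<sigma> \<and> ennreal \<sigma> < 2 * maximal_function f x}. D (ennreal \<sigma>) / ennreal \<sigma> \<partial>lborel)"
      by (rule young_function_le_slope_integral[OF D])
    also have "\<dots> = (\<integral>\<^sup>+\<sigma>. (if 0 < \<sigma> \<and> ennreal \<sigma> < 2 * maximal_function f x then D (ennreal \<sigma>) / ennreal \<sigma> else 0)
            \<partial>lborel)"
      by (intro nn_integral_cong) auto
    finally show "D (maximal_function f x) \<le> \<dots>" .
  qed
  also have "\<dots> = (\<integral>\<^sup>+\<sigma>. \<integral>\<^sup>+x. (if 0 < \<sigma> \<and> ennreal \<sigma> < 2 * maximal_function f x then D (ennreal \<sigma>) / ennreal \<sigma> else 0)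
            \<partial>lebesgue \<partial>lborel)"
    using Fubini_lborel_lebesgue[of "\<lambda>(\<sigma>, x). if 0 < \<sigma> \<and> ennreal \<sigma> < 2 * maximal_function f x
      then D (ennreal \<sigma>) / ennreal \<sigma> else 0"] by simp
  also have "\<dots> \<le> (\<integral>\<^sup>+\<sigma>. \<integral>\<^sup>+x. (if 0 < \<sigma> \<and> \<sigma> < 4 * \<bar>f x\<bar>
      then ennreal (2 * w) * (D (ennreal \<sigma>) / ennreal (\<sigma>\<^sup>2)) * ennreal \<bar>f x\<bar> else 0) \<partial>lebesgue \<partial>lborel)"
  proof (rule nn_integral_mono)
    fix \<sigma> :: real
    show "(\<integral>\<^sup>+x. (if 0 < \<sigma> \<and> ennreal \<sigma> < 2 * maximal_function f x then D (ennreal \<sigma>) / ennreal \<sigma> else 0) \<partial>lebesgue)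
      \<le> (\<integral>\<^sup>+x. (if 0 < \<sigma> \<and> \<sigma> < 4 * \<bar>f x\<bar>
            then ennreal (2 * w) * (D (ennreal \<sigma>) / ennreal (\<sigma>\<^sup>2)) * ennreal \<bar>f x\<bar> else 0) \<partial>lebesgue)"
    proof (cases "0 < \<sigma>")
      case True
      have half: "ennreal \<sigma> < 2 * y \<longleftrightarrow> ennreal (\<sigma> / 2) < y" for y
        using True by (cases y) (auto simp: ennreal_mult_top ennreal_less_iff simp flip: ennreal_numeral ennreal_mult)
      have "(\<integral>\<^sup>+x. (if 0 < \<sigma> \<and> ennreal \<sigma> < 2 * maximal_function f x then D (ennreal \<sigma>) / ennreal \<sigma> else 0) \<partial>lebesgue)
          = (\<integral>\<^sup>+x. D (ennreal \<sigma>) / ennreal \<sigma> * indicator {x. ennreal (\<sigma> / 2) < maximal_function f x} x \<partial>lebesgue)"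
        using True by (intro nn_integral_cong) (auto simp: half)
      also have "\<dots> = D (ennreal \<sigma>) / ennreal \<sigma> * emeasure lebesgue {x. ennreal (\<sigma> / 2) < maximal_function f x}"
        by (rule nn_integral_cmult_indicator) (simp add: borel_open open_maximal_function_gt)
      also have "\<dots> \<le> D (ennreal \<sigma>) / ennreal \<sigma> *
          (ennreal (w / (\<sigma> / 2)) * (\<integral>\<^sup>+x\<in>{x. \<sigma> / 2 / 2 < \<bar>f x\<bar>}. ennreal \<bar>f x\<bar> \<partial>lebesgue))"
        unfolding w_def by (intro mult_left_mono maximal_function_weak_type f) (use True in auto)
      also have "\<dots> = (D (ennreal \<sigma>) / ennreal \<sigma> * ennreal (w / (\<sigma> / 2))) *
          (\<integral>\<^sup>+x\<in>{x. \<sigma> / 2 / 2 < \<bar>f x\<bar>}. ennreal \<bar>f x\<bar> \<partial>lebesgue)" by (simp add: mult.assoc)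
      also have "D (ennreal \<sigma>) / ennreal \<sigma> * ennreal (w / (\<sigma> / 2))
          = ennreal (2 * w) * (D (ennreal \<sigma>) / ennreal (\<sigma>\<^sup>2))"
      proof -
        have "inverse (ennreal \<sigma>) * ennreal (w / (\<sigma> / 2)) = ennreal (2 * w) * inverse (ennreal (\<sigma>\<^sup>2))"
          using True w by (simp add: inverse_ennreal field_simps power2_eq_square flip: ennreal_mult)
        then show ?thesis unfolding divide_ennreal_def by (metis mult.assoc mult.commute)
      qed
      also have "ennreal (2 * w) * (D (ennreal \<sigma>) / ennreal (\<sigma>\<^sup>2)) * (\<integral>\<^sup>+x\<in>{x. \<sigma> / 2 / 2 < \<bar>f x\<bar>}. ennreal \<bar>f x\<bar> \<partial>lebesgue)
          = (\<integral>\<^sup>+x. ennreal (2 * w) * (D (ennreal \<sigma>) / ennreal (\<sigma>\<^sup>2)) * (ennreal \<bar>f x\<bar> * indicator {x. \<sigma> / 2 / 2 < \<bar>f x\<bar>} x) \<partial>lebesgue)"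
        by (rule nn_integral_cmult[symmetric]) measurable
      also have "\<dots> = (\<integral>\<^sup>+x. (if 0 < \<sigma> \<and> \<sigma> < 4 * \<bar>f x\<bar>
            then ennreal (2 * w) * (D (ennreal \<sigma>) / ennreal (\<sigma>\<^sup>2)) * ennreal \<bar>f x\<bar> else 0) \<partial>lebesgue)"
        using True by (intro nn_integral_cong) (auto split: split_indicator)
      finally show ?thesis .
    qed simp
  qed
  also have "\<dots> = (\<integral>\<^sup>+x. \<integral>\<^sup>+\<sigma>. (if 0 < \<sigma> \<and> \<sigma> < 4 * \<bar>f x\<bar>
      then ennreal (2 * w) * (D (ennreal \<sigma>) / ennreal (\<sigma>\<^sup>2)) * ennreal \<bar>f x\<bar> else 0) \<partial>lborel \<partial>lebesgue)"
    using Fubini_lborel_lebesgue[of "\<lambda>(\<sigma>, x). if 0 < \<sigma> \<and> \<sigma> < 4 * \<bar>f x\<bar>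
      then ennreal (2 * w) * (D (ennreal \<sigma>) / ennreal (\<sigma>\<^sup>2)) * ennreal \<bar>f x\<bar> else 0"] by simp
  also have "\<dots> \<le> (\<integral>\<^sup>+x. ennreal (2 * w) * A (ennreal (4 * K * \<bar>f x\<bar>)) \<partial>lebesgue)"
  proof (rule nn_integral_mono)
    fix x
    show "(\<integral>\<^sup>+\<sigma>. (if 0 < \<sigma> \<and> \<sigma> < 4 * \<bar>f x\<bar>
      then ennreal (2 * w) * (D (ennreal \<sigma>) / ennreal (\<sigma>\<^sup>2)) * ennreal \<bar>f x\<bar> else 0) \<partial>lborel)
      \<le> ennreal (2 * w) * A (ennreal (4 * K * \<bar>f x\<bar>))"
    proof (cases "f x = 0")
      case True
      then have "(\<integral>\<^sup>+\<sigma>. (if 0 < \<sigma> \<and> \<sigma> < 4 * \<bar>f x\<bar>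
        then ennreal (2 * w) * (D (ennreal \<sigma>) / ennreal (\<sigma>\<^sup>2)) * ennreal \<bar>f x\<bar> else 0) \<partial>lborel) = (\<integral>\<^sup>+\<sigma>. 0 \<partial>(lborel::real measure))"
        by (intro nn_integral_cong) auto
      then show ?thesis by simp
    next
      case False
      define a where "a = \<bar>f x\<bar>"
      have a: "0 < a" using False by (simp add: a_def)
      have "(\<integral>\<^sup>+\<sigma>. (if 0 < \<sigma> \<and> \<sigma> < 4 * a
          then ennreal (2 * w) * (D (ennreal \<sigma>) / ennreal (\<sigma>\<^sup>2)) * ennreal a else 0) \<partial>lborel)
        = (\<integral>\<^sup>+\<sigma>. ennreal (2 * w) * ennreal a * (D (ennreal \<sigma>) / ennreal (\<sigma>\<^sup>2) * indicator {0<..<4 * a} \<sigma>) \<partial>lborel)"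
        by (intro nn_integral_cong) (auto split: split_indicator simp: mult_ac)
      also have "\<dots> = ennreal (2 * w) * ennreal a * (\<integral>\<^sup>+\<sigma>\<in>{0<..<4 * a}. D (ennreal \<sigma>) / ennreal (\<sigma>\<^sup>2) \<partial>lborel)"
        by (rule nn_integral_cmult) measurable
      also have "\<dots> \<le> ennreal (2 * w) * ennreal a * (A (ennreal (K * (4 * a))) / ennreal (4 * a))"
        using IC a by (intro mult_left_mono) (auto simp: slope_integral_bound_def)
      also have "\<dots> = ennreal (2 * w) * (ennreal (a / (4 * a)) * A (ennreal (4 * K * a)))"
      proof -
        have "ennreal a * inverse (ennreal (4 * a)) = ennreal (a / (4 * a))"
          by (rule divide_ennreal[unfolded divide_ennreal_def]) (use a in auto)
        moreover have "ennreal a * (A (ennreal (4 * K * a)) * inverse (ennreal (4 * a)))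
            = (ennreal a * inverse (ennreal (4 * a))) * A (ennreal (4 * K * a))" by (simp only: mult_ac)
        moreover have "K * (4 * a) = 4 * K * a" by simp
        ultimately show ?thesis unfolding divide_ennreal_def by (simp only: mult.assoc)
      qed
      also have "\<dots> \<le> ennreal (2 * w) * (1 * A (ennreal (4 * K * a)))"
        using a by (intro mult_left_mono mult_right_mono) auto
      finally show ?thesis unfolding a_def by simp
    qed
  qed
  finally have "(\<integral>\<^sup>+x. D (maximal_function f x) \<partial>lebesgue)
    \<le> (\<integral>\<^sup>+x. ennreal (2 * w) * A (ennreal (4 * K * \<bar>f x\<bar>)) \<partial>lebesgue)" .
  also have "\<dots> = ennreal (2 * w) * (\<integral>\<^sup>+x. A (ennreal (4 * K * \<bar>f x\<bar>)) \<partial>lebesgue)"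
    by (rule nn_integral_cmult) measurable
  finally show ?thesis unfolding w_def .
qed

text \<open>The modular bound carries a factor that may exceed 1; convexity absorbs it into the norm by
  dividing the argument of \<open>D\<close> by \<open>N\<close>.\<close>

lemma maximal_bounded_of_slope_integral_bound:
  assumes A: "young_function A" and D: "young_function D" and K: "0 < K"
    and IC: "slope_integral_bound A D K"
  shows "maximal_bounded TYPE('n::finite) A D"
proof -
  define w where "w = weak_type_const CARD('n)"
  have w: "0 < w" unfolding w_def by (rule weak_type_const_pos) simp
  define N where "N = max 1 (2 * w)"
  have N: "1 \<le> N" "2 * w \<le> N" by (auto simp: N_def)
  show ?thesis
    unfolding maximal_bounded_def
  proof (intro exI[of _ "4 * K * N"] conjI ballI)
    show "0 < 4 * K * N" using K N by simp
    fix f :: "real ^ 'n \<Rightarrow> real" assume "f \<in> orlicz_space A"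
    then have f[measurable]: "f \<in> borel_measurable lebesgue" by (simp add: orlicz_space_def)
    show "luxemburg_norm D (maximal_function f) \<le> ennreal (4 * K * N) * luxemburg_norm A (\<lambda>x. ennreal \<bar>f x\<bar>)"
    proof (rule le_mult_luxemburg_norm)
      show "0 < 4 * K * N" using K N by simp
      fix l :: real assume l: "0 < l" "(\<integral>\<^sup>+x. A (ennreal \<bar>f x\<bar> / ennreal l) \<partial>lebesgue) \<le> 1"
      define g where "g x = 1 / (4 * K * l) * f x" for x
      have g[measurable]: "g \<in> borel_measurable lebesgue" unfolding g_def by measurable
      have Mg: "maximal_function g x = ennreal (1 / (4 * K * l)) * maximal_function f x" for x
        unfolding g_def using K l by (intro maximal_function_cmult f) simp
      have "(\<integral>\<^sup>+x. D (maximal_function g x) \<partial>lebesgue)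
          \<le> ennreal (2 * w) * (\<integral>\<^sup>+x. A (ennreal (4 * K * \<bar>g x\<bar>)) \<partial>lebesgue)"
        unfolding w_def by (rule maximal_function_modular_bound[OF A D g IC])
      also have "(\<integral>\<^sup>+x. A (ennreal (4 * K * \<bar>g x\<bar>)) \<partial>lebesgue) = (\<integral>\<^sup>+x. A (ennreal \<bar>f x\<bar> / ennreal l) \<partial>lebesgue)"
        using K l(1) by (intro nn_integral_cong) (simp add: g_def abs_mult divide_ennreal)
      also have "ennreal (2 * w) * \<dots> \<le> ennreal (2 * w) * 1" using l(2) by (rule mult_left_mono) simp
      finally have int: "(\<integral>\<^sup>+x. D (maximal_function g x) \<partial>lebesgue) \<le> ennreal (2 * w)" by simp
      show "luxemburg_norm D (maximal_function f) \<le> ennreal (4 * K * N * l)"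
      proof (rule luxemburg_norm_leI)
        show "0 < 4 * K * N * l" using K N l by simp
        have "(\<integral>\<^sup>+x. D (maximal_function f x / ennreal (4 * K * N * l)) \<partial>lebesgue)
            \<le> (\<integral>\<^sup>+x. ennreal (1 / N) * D (maximal_function g x) \<partial>lebesgue)"
        proof (rule nn_integral_mono)
          fix x
          have "maximal_function f x / ennreal (4 * K * N * l) = maximal_function f x * ennreal (1 / N * (1 / (4 * K * l)))"
            using K N l unfolding divide_ennreal_def by (subst inverse_ennreal) (auto simp: field_simps)
          also have "\<dots> = ennreal (1 / N) * maximal_function g x"
            unfolding Mg using K N l by (subst ennreal_mult) (auto simp: mult_ac)
          finally show "D (maximal_function f x / ennreal (4 * K * N * l)) \<le> ennreal (1 / N) * D (maximal_function g x)"
            using young_function_scale_le[OF D, of "1 / N"] N by simp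
        qed
        also have "\<dots> = ennreal (1 / N) * (\<integral>\<^sup>+x. D (maximal_function g x) \<partial>lebesgue)"
          by (rule nn_integral_cmult, rule measurable_compose[OF _ young_function_measurable[OF D]]) measurable
        also have "\<dots> \<le> ennreal (1 / N) * ennreal (2 * w)" using int by (rule mult_left_mono) simp
        also have "\<dots> = ennreal (2 * w / N)" using N w by (subst ennreal_mult[symmetric]) auto
        also have "\<dots> \<le> 1" using N by simp
        finally show "(\<integral>\<^sup>+x. D (maximal_function f x / ennreal (4 * K * N * l)) \<partial>lebesgue) \<le> 1" .
      qed
    qed
  qed
qed

text \<open>For \<open>f = T 1\<^sub>Q\<close> with \<open>|Q| = m\<close> and \<open>T = K t\<close>, the maximal function is at least \<open>K \<sigma>\<close> on the cube
  around \<open>Q\<close> of measure \<open>m t / \<sigma>\<close>, for every \<open>\<sigma> < t\<close>.\<close>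

lemma maximal_bounded_cube_test:
  assumes A: "young_function A" and D: "young_function D"
    and C: "0 < C" and bdd: "\<And>f :: real ^ 'n \<Rightarrow> real. f \<in> orlicz_space A \<Longrightarrow>
      luxemburg_norm D (maximal_function f) \<le> ennreal C * luxemburg_norm A (\<lambda>x. ennreal \<bar>f x\<bar>)"
    and K: "C < K" and t: "0 < t" and m: "0 < m" "ennreal m * A (ennreal (K * t)) \<le> 1"
  shows "(\<integral>\<^sup>+\<tau>\<in>{0<..<t}. D (ennreal \<tau>) / ennreal (\<tau>\<^sup>2) \<partial>lborel) \<le> ennreal (1 / (t * m))"
proof -
  let ?n = "CARD('n)"
  define T where "T = K * t"
  have K0: "0 < K" using C K by simp
  have T: "0 < T" using K0 t by (simp add: T_def)
  define Q :: "real \<Rightarrow> (real ^ 'n) set" where "Q s = cbox 0 (0 + (\<chi> i. s))" for s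
  define f where "f x = T * indicator (Q (root ?n m)) x" for x :: "real ^ 'n"
  have Q[measurable]: "Q s \<in> sets lebesgue" for s by (simp add: Q_def)
  have Qm: "emeasure lebesgue (Q (root ?n v) :: (real ^ 'n) set) = ennreal v" if "0 \<le> v" for v
    unfolding Q_def using that by (subst emeasure_cube) (auto simp: real_root_pow_pos2)
  have f[measurable]: "f \<in> borel_measurable lebesgue" unfolding f_def by measurable
  have "luxemburg_norm A (\<lambda>x. ennreal \<bar>f x\<bar>) \<le> ennreal 1"
  proof (rule luxemburg_norm_leI)
    have "(\<integral>\<^sup>+x. A (ennreal \<bar>f x\<bar> / ennreal 1) \<partial>lebesgue)
        = (\<integral>\<^sup>+x. A (ennreal T) * indicator (Q (root ?n m) :: (real ^ 'n) set) x \<partial>lebesgue)"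
      using T young_function_0[OF A]
      by (intro nn_integral_cong) (auto simp: f_def divide_ennreal_def split: split_indicator)
    also have "\<dots> = A (ennreal T) * ennreal m"
      using m by (subst nn_integral_cmult_indicator) (auto simp only: Q Qm less_imp_le)
    finally show "(\<integral>\<^sup>+x. A (ennreal \<bar>f x\<bar> / ennreal 1) \<partial>lebesgue) \<le> 1"
      using m by (simp add: T_def mult.commute)
  qed simp
  then have norm: "luxemburg_norm A (\<lambda>x. ennreal \<bar>f x\<bar>) \<le> 1" by simp
  then have fA: "f \<in> orlicz_space A"
    unfolding orlicz_space_def by (auto simp: less_top[symmetric] top_unique)
  have "luxemburg_norm D (maximal_function f) \<le> ennreal C * luxemburg_norm A (\<lambda>x. ennreal \<bar>f x\<bar>)"
    by (rule bdd[OF fA])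
  also have "\<dots> \<le> ennreal C * 1" using norm by (rule mult_left_mono) simp
  also have "\<dots> < ennreal K" using C K by (simp add: ennreal_less_iff)
  finally have int: "(\<integral>\<^sup>+x. D (maximal_function f x / ennreal K) \<partial>lebesgue) \<le> 1"
    by (rule luxemburg_norm_lessD[OF D])
  have large: "ennreal \<sigma> \<le> maximal_function f x / ennreal K"
    if \<sigma>: "0 < \<sigma>" "\<sigma> < t" and x: "x \<in> Q (root ?n (m * t / \<sigma>))" for \<sigma> x
  proof -
    \<comment> \<open>\<open>f\<close> has integral \<open>T m = K t m\<close>, hence mean \<open>K \<sigma>\<close> over a cube of measure \<open>m t / \<sigma>\<close> that contains its support.\<close>
    let ?v = "m * t / \<sigma>"
    have v: "m < ?v" using \<sigma> m by (simp add: field_simps)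
    have sub: "Q (root ?n m) \<subseteq> (Q (root ?n ?v) :: (real ^ 'n) set)"
      unfolding Q_def using v by (intro cube_subset_cube) simp
    have "is_cube (Q (root ?n ?v) :: (real ^ 'n) set)"
      unfolding is_cube_def Q_def using v m by (intro exI[of _ 0] exI[of _ "root ?n ?v"]) auto
    then have "(\<integral>\<^sup>+y\<in>Q (root ?n ?v). ennreal \<bar>f y\<bar> \<partial>lebesgue) / emeasure lebesgue (Q (root ?n ?v) :: (real ^ 'n) set)
        \<le> maximal_function f x"
      unfolding maximal_function_def using x by (intro SUP_upper) simp
    moreover have "(\<integral>\<^sup>+y\<in>Q (root ?n ?v). ennreal \<bar>f y\<bar> \<partial>lebesgue)
        = (\<integral>\<^sup>+y. ennreal T * indicator (Q (root ?n m) :: (real ^ 'n) set) y \<partial>lebesgue)"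
      using sub T by (intro nn_integral_cong) (auto simp: f_def split: split_indicator)
    moreover have "\<dots> = ennreal (T * m)"
      using m T by (subst nn_integral_cmult_indicator) (auto simp only: Q Qm less_imp_le ennreal_mult)
    moreover have "emeasure lebesgue (Q (root ?n ?v) :: (real ^ 'n) set) = ennreal ?v"
      using v m by (intro Qm) simp
    ultimately have "ennreal (T * m) / ennreal ?v \<le> maximal_function f x" by simp
    also have "ennreal (T * m) / ennreal ?v = ennreal (K * \<sigma>)"
      using T m \<sigma> t by (subst divide_ennreal) (auto simp: T_def)
    finally have "ennreal (K * \<sigma>) / ennreal K \<le> maximal_function f x / ennreal K"
      by (rule divide_right_mono_ennreal)
    then show ?thesis using K0 \<sigma> by (simp add: divide_ennreal)
  qed
  note [measurable] = young_function_measurable[OF D]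
  let ?I = "\<integral>\<^sup>+\<tau>\<in>{0<..<t}. D (ennreal \<tau>) / ennreal (\<tau>\<^sup>2) \<partial>lborel"
  have "ennreal (m * t) * ?I = (\<integral>\<^sup>+\<sigma>. ennreal (m * t) * (D (ennreal \<sigma>) / ennreal (\<sigma>\<^sup>2) * indicator {0<..<t} \<sigma>) \<partial>lborel)"
    by (rule nn_integral_cmult[symmetric]) measurable
  also have "\<dots> \<le> (\<integral>\<^sup>+\<sigma>. \<integral>\<^sup>+x. (if 0 < \<sigma> \<and> ennreal \<sigma> \<le> maximal_function f x / ennreal K
      then D (ennreal \<sigma>) / ennreal \<sigma> else 0) \<partial>lebesgue \<partial>lborel)"
  proof (rule nn_integral_mono)
    fix \<sigma> :: real
    show "ennreal (m * t) * (D (ennreal \<sigma>) / ennreal (\<sigma>\<^sup>2) * indicator {0<..<t} \<sigma>)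
      \<le> (\<integral>\<^sup>+x. (if 0 < \<sigma> \<and> ennreal \<sigma> \<le> maximal_function f x / ennreal K
            then D (ennreal \<sigma>) / ennreal \<sigma> else 0) \<partial>lebesgue)"
    proof (cases "0 < \<sigma> \<and> \<sigma> < t")
      case True
      have "inverse (ennreal \<sigma>) * ennreal (m * t / \<sigma>) = ennreal (m * t) * inverse (ennreal (\<sigma>\<^sup>2))"
        using True m t by (simp add: inverse_ennreal field_simps power2_eq_square flip: ennreal_mult)
      then have "ennreal (m * t) * (D (ennreal \<sigma>) / ennreal (\<sigma>\<^sup>2)) = D (ennreal \<sigma>) / ennreal \<sigma> * ennreal (m * t / \<sigma>)"
        unfolding divide_ennreal_def by (metis mult.assoc mult.commute)
      also have "ennreal (m * t / \<sigma>) = emeasure lebesgue (Q (root ?n (m * t / \<sigma>)) :: (real ^ 'n) set)"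
        using True m by (intro Qm[symmetric]) auto
      also have "D (ennreal \<sigma>) / ennreal \<sigma> * \<dots>
          = (\<integral>\<^sup>+x. D (ennreal \<sigma>) / ennreal \<sigma> * indicator (Q (root ?n (m * t / \<sigma>)) :: (real ^ 'n) set) x \<partial>lebesgue)"
        by (rule nn_integral_cmult_indicator[symmetric]) (rule Q)
      also have "\<dots> \<le> (\<integral>\<^sup>+x. (if 0 < \<sigma> \<and> ennreal \<sigma> \<le> maximal_function f x / ennreal K
            then D (ennreal \<sigma>) / ennreal \<sigma> else 0) \<partial>lebesgue)"
        using True large by (intro nn_integral_mono) (auto split: split_indicator)
      finally show ?thesis using True by simp
    qed auto
  qed
  also have "\<dots> = (\<integral>\<^sup>+x. \<integral>\<^sup>+\<sigma>. (if 0 < \<sigma> \<and> ennreal \<sigma> \<le> maximal_function f x / ennreal K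
      then D (ennreal \<sigma>) / ennreal \<sigma> else 0) \<partial>lborel \<partial>lebesgue)"
    using Fubini_lborel_lebesgue[of "\<lambda>(\<sigma>, x). if 0 < \<sigma> \<and> ennreal \<sigma> \<le> maximal_function f x / ennreal K
      then D (ennreal \<sigma>) / ennreal \<sigma> else 0"] by simp
  also have "\<dots> \<le> (\<integral>\<^sup>+x. D (maximal_function f x / ennreal K) \<partial>lebesgue)"
  proof (rule nn_integral_mono)
    fix x
    let ?u = "maximal_function f x / ennreal K"
    have "(\<integral>\<^sup>+\<sigma>. (if 0 < \<sigma> \<and> ennreal \<sigma> \<le> ?u then D (ennreal \<sigma>) / ennreal \<sigma> else 0) \<partial>lborel)
        = (\<integral>\<^sup>+\<sigma>\<in>{\<sigma>. 0 < \<sigma> \<and> ennreal \<sigma> \<le> ?u}. D (ennreal \<sigma>) / ennreal \<sigma> \<partial>lborel)"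
      by (intro nn_integral_cong) auto
    also have "\<dots> \<le> D ?u" by (rule slope_integral_le_young_function[OF D])
    finally show "(\<integral>\<^sup>+\<sigma>. (if 0 < \<sigma> \<and> ennreal \<sigma> \<le> ?u then D (ennreal \<sigma>) / ennreal \<sigma> else 0) \<partial>lborel) \<le> D ?u" .
  qed
  also have "\<dots> \<le> 1" by (rule int)
  finally have le: "ennreal (m * t) * ?I \<le> 1" .
  have "?I = ennreal (1 / (t * m)) * (ennreal (m * t) * ?I)"
    using m t by (simp flip: mult.assoc ennreal_mult)
  also have "\<dots> \<le> ennreal (1 / (t * m)) * 1" using le by (rule mult_left_mono) simp
  finally show ?thesis by simp
qed

text \<open>The best choice in the cube test is \<open>m = 1 / A(K t)\<close>; where \<open>A(K t) = 0\<close>, all \<open>m\<close> are allowed and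
  the integral vanishes.\<close>

lemma slope_integral_bound_of_maximal_bounded:
  assumes A: "young_function A" and D: "young_function D"
    and bdd: "maximal_bounded TYPE('n::finite) A D"
  obtains K where "0 < K" "slope_integral_bound A D K"
proof -
  obtain C where C: "0 < C" "\<And>f :: real ^ 'n \<Rightarrow> real. f \<in> orlicz_space A \<Longrightarrow>
      luxemburg_norm D (maximal_function f) \<le> ennreal C * luxemburg_norm A (\<lambda>x. ennreal \<bar>f x\<bar>)"
    using bdd unfolding maximal_bounded_def by blast
  define K where "K = C + 1"
  have test: "(\<integral>\<^sup>+\<tau>\<in>{0<..<t}. D (ennreal \<tau>) / ennreal (\<tau>\<^sup>2) \<partial>lborel) \<le> ennreal (1 / (t * m))"
    if "0 < t" "0 < m" "ennreal m * A (ennreal (K * t)) \<le> 1" for t m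
    by (rule maximal_bounded_cube_test[OF A D C(1) C(2) _ that]) (auto simp: K_def)
  have "(\<integral>\<^sup>+\<tau>\<in>{0<..<t}. D (ennreal \<tau>) / ennreal (\<tau>\<^sup>2) \<partial>lborel) \<le> A (ennreal (K * t)) / ennreal t"
    if t: "0 < t" for t
  proof (cases "A (ennreal (K * t))")
    case top
    then show ?thesis using t by (simp add: ennreal_top_divide)
  next
    case (real \<alpha>)
    show ?thesis
    proof (cases "\<alpha> = 0")
      case True
      show ?thesis
      proof (rule ennreal_le_epsilon)
        fix e :: real assume e: "0 < e"
        show "(\<integral>\<^sup>+\<tau>\<in>{0<..<t}. D (ennreal \<tau>) / ennreal (\<tau>\<^sup>2) \<partial>lborel) \<le> A (ennreal (K * t)) / ennreal t + ennreal e"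
          using test[OF t, of "1 / (t * e)"] t e True real by simp
      qed
    next
      case False
      then show ?thesis
        using test[OF t, of "1 / \<alpha>"] t real by (simp add: divide_ennreal flip: ennreal_mult)
    qed
  qed
  then show thesis using that[of K] C by (auto simp: slope_integral_bound_def K_def)
qed

lemma maximal_bounded_of_dominated:
  assumes "maximal_bounded TYPE('n::finite) A B" "0 < C" "\<And>x. D x \<le> B (ennreal C * x)"
  shows "maximal_bounded TYPE('n) A D"
proof -
  obtain c where c: "0 < c" "\<And>f :: real ^ 'n \<Rightarrow> real. f \<in> orlicz_space A \<Longrightarrow>
      luxemburg_norm B (maximal_function f) \<le> ennreal c * luxemburg_norm A (\<lambda>x. ennreal \<bar>f x\<bar>)"
    using assms(1) unfolding maximal_bounded_def by blast
  show ?thesis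
    unfolding maximal_bounded_def
  proof (intro exI[of _ "C * c"] conjI ballI)
    show "0 < C * c" using c assms by simp
    fix f :: "real ^ 'n \<Rightarrow> real" assume f: "f \<in> orlicz_space A"
    have "luxemburg_norm D (maximal_function f) \<le> ennreal C * luxemburg_norm B (maximal_function f)"
      by (rule luxemburg_norm_mono[where D = D and B = B and C = C, OF assms(2,3)])
    also have "\<dots> \<le> ennreal C * (ennreal c * luxemburg_norm A (\<lambda>x. ennreal \<bar>f x\<bar>))"
      by (intro mult_left_mono c f) simp
    also have "\<dots> = ennreal (C * c) * luxemburg_norm A (\<lambda>x. ennreal \<bar>f x\<bar>)"
      using c assms by (simp add: ennreal_mult mult.assoc)
    finally show "luxemburg_norm D (maximal_function f) \<le> \<dots>" .
  qed
qed

section \<open>Every target is dominated by the optimal Young function\<close>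

text \<open>An affine minorant of an admissible \<open>D\<close> is itself admissible, so the duality for hinges applies.\<close>

lemma exp_average_complementary_le_of_slope_integral_bound:
  assumes IC: "slope_integral_bound A D K" and K: "0 < K" and r: "0 < r" and b: "0 < b"
    and line: "\<And>\<sigma>. 0 \<le> \<sigma> \<Longrightarrow> ennreal (r * \<sigma> - b) \<le> D (ennreal \<sigma>)"
  shows "exp_average_complementary A (ennreal (r / (2 * K))) \<le> ennreal (2 * b)"
proof (rule exp_average_complementary_le[OF r b K])
  fix s :: real assume s: "0 \<le> s"
  show "complementary A (ennreal (s / K)) \<le> ennreal (b * exp (s / r))"
  proof (rule complementary_le_exp[OF r b K s])
    fix t assume t: "b / r < t"
    have t0: "0 < t" using t r b by (meson divide_pos_pos less_trans)
    have "ennreal (r * ln (t * r / b) - r + b / t)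
        = (\<integral>\<^sup>+\<tau>\<in>{0<..<t}. ennreal (r * \<tau> - b) / ennreal (\<tau>\<^sup>2) \<partial>lborel)"
      using t by (simp add: nn_integral_hinge[OF r b t0])
    also have "\<dots> \<le> (\<integral>\<^sup>+\<tau>\<in>{0<..<t}. D (ennreal \<tau>) / ennreal (\<tau>\<^sup>2) \<partial>lborel)"
      using line by (intro nn_integral_mono) (auto split: split_indicator intro: divide_right_mono_ennreal)
    also have "\<dots> \<le> A (ennreal (K * t)) / ennreal t"
      using IC t0 by (simp add: slope_integral_bound_def)
    finally show "ennreal (r * ln (t * r / b) - r + b / t) \<le> A (ennreal (K * t)) / ennreal t" .
  qed
qed

text \<open>By the preceding lemma each affine minorant \<open>r \<sigma> - b\<close> of \<open>D\<close> gives
  \<open>BA\<^sup>~(r / (2 K)) \<le> 2 b\<close>, and Young's inequality turns this into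
  \<open>2 (r \<tau> - b) \<le> BA(4 K \<tau>)\<close>.\<close>

lemma le_of_slope_integral_bound:
  assumes IC: "slope_integral_bound A D K" and K: "0 < K" and D: "young_function D"
    and BA: "young_function BA" "\<And>t. complementary BA t = exp_average_complementary A t"
  shows "D x \<le> BA (ennreal (4 * K) * x)"
proof (cases x)
  case top
  then show ?thesis using K young_function_top[OF BA(1)] by (simp add: ennreal_mult_top)
next
  case (real \<tau>)
  show ?thesis
  proof (rule ccontr)
    assume "\<not> ?thesis"
    then have lt: "BA (ennreal (4 * K) * x) < D x" by simp
    then obtain m where m: "BA (ennreal (4 * K) * x) = ennreal m" "0 \<le> m"
      by (cases "BA (ennreal (4 * K) * x)") auto
    have "\<tau> \<noteq> 0" using lt real young_function_0[OF D] by auto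
    then have \<tau>: "0 < \<tau>" using real by simp
    obtain r b where r: "0 < r" "0 < b" "m < r * \<tau> - b"
      and line: "\<And>\<sigma>. 0 \<le> \<sigma> \<Longrightarrow> ennreal (r * \<sigma> - b) \<le> D (ennreal \<sigma>)"
      using young_function_supporting_line[OF D \<tau> m(2)] lt m real by metis
    have "ennreal (4 * K * \<tau> * (r / (2 * K))) = ennreal (4 * K * \<tau>) * ennreal (r / (2 * K))"
      using K \<tau> r by (intro ennreal_mult) auto
    also have "\<dots> \<le> BA (ennreal (4 * K * \<tau>)) + complementary BA (ennreal (r / (2 * K)))"
      using K \<tau> by (intro young_inequality) simp
    also have "\<dots> \<le> ennreal m + ennreal (2 * b)"
    proof (intro add_mono)
      show "BA (ennreal (4 * K * \<tau>)) \<le> ennreal m"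
        using m real K by (simp flip: ennreal_mult)
      show "complementary BA (ennreal (r / (2 * K))) \<le> ennreal (2 * b)"
        unfolding BA(2) by (rule exp_average_complementary_le_of_slope_integral_bound[OF IC K r(1,2) line])
    qed
    also have "\<dots> = ennreal (m + 2 * b)" using m r by simp
    finally have "4 * K * \<tau> * (r / (2 * K)) \<le> m + 2 * b"
      by (rule ennreal_le_iff[THEN iffD1, rotated]) (use m r in simp)
    moreover have "4 * K * \<tau> * (r / (2 * K)) = 2 * (r * \<tau>)" using K by (simp add: field_simps)
    ultimately show False using r m by linarith
  qed
qed

lemma smallest_of_maximal_bounded:
  assumes A: "young_function A"
    and BA: "young_function BA" "\<And>t. complementary BA t = exp_average_complementary A t"
    and bdd: "maximal_bounded TYPE('n::finite) A BA"
  shows "smallest_orlicz_target TYPE('n) A BA"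
  unfolding smallest_orlicz_target_def
proof (intro conjI allI impI BA(1) bdd)
  fix D assume D: "young_function D" "maximal_bounded TYPE('n) A D"
  obtain K where K: "0 < K" "slope_integral_bound A D K"
    using slope_integral_bound_of_maximal_bounded[OF A D] .
  show "(orlicz_space BA :: (real ^ 'n \<Rightarrow> real) set) \<subseteq> orlicz_space D"
    by (rule orlicz_space_mono[of "4 * K"]) (use K le_of_slope_integral_bound[OF K(2,1) D(1) BA] in auto)
qed

text \<open>A single affine minorant with positive slope suffices to make the exponential average finite.\<close>

lemma exp_average_finite_of_maximal_bounded:
  assumes A: "young_function A" and B: "young_function B" and bdd: "maximal_bounded TYPE('n::finite) A B"
  shows "\<exists>t0>0. exp_average_complementary A (ennreal t0) < \<infinity>"
proof -
  obtain K where K: "0 < K" "slope_integral_bound A B K"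
    using slope_integral_bound_of_maximal_bounded[OF A B bdd] .
  obtain t where t: "0 < t" "B t \<noteq> 0" using B by (auto simp: young_function_def)
  have "\<exists>\<tau>>0. 0 < B (ennreal \<tau>)"
  proof (rule ccontr)
    assume neg: "\<not> ?thesis"
    have "B t \<le> 0"
    proof (rule young_function_le_of_lt[OF B t(1)])
      fix y assume "y < t"
      then obtain u where u: "y = ennreal u" "0 \<le> u" by (cases y) auto
      show "B y \<le> 0"
      proof (cases "u = 0")
        case True
        then show ?thesis using u young_function_0[OF B] by simp
      next
        case False
        then have "\<not> 0 < B (ennreal u)" using neg u by (metis le_less)
        then show ?thesis using u by (simp add: not_less)
      qed
    qed
    then show False using t by simp
  qed
  then obtain \<tau> where \<tau>: "0 < \<tau>" "ennreal 0 < B (ennreal \<tau>)" by auto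
  obtain r b where rb: "0 < r" "0 < b" "\<And>\<sigma>. 0 \<le> \<sigma> \<Longrightarrow> ennreal (r * \<sigma> - b) \<le> B (ennreal \<sigma>)"
    using young_function_supporting_line[OF B \<tau>(1) order_refl \<tau>(2)] by metis
  have "exp_average_complementary A (ennreal (r / (2 * K))) \<le> ennreal (2 * b)"
    by (rule exp_average_complementary_le_of_slope_integral_bound[OF K(2,1) rb])
  also have "\<dots> < \<infinity>" by simp
  finally show ?thesis using rb K by (intro exI[of _ "r / (2 * K)"]) auto
qed

section \<open>A smallest target dominates the optimal Young function\<close>

text \<open>Truncated subtraction on \<^typ>\<open>ennreal\<close> makes each summand a hinge \<open>max 0 (r x - c)\<close>; the weights
  have sum 1, so that a bound shared by all hinges passes to the sum.\<close>

definition hinge_sum :: "(nat \<Rightarrow> real) \<Rightarrow> (nat \<Rightarrow> real) \<Rightarrow> ennreal \<Rightarrow> ennreal" where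
  "hinge_sum r c x = (\<Sum>k. ennreal ((1/2) ^ Suc k) * (ennreal (r k) * x - ennreal (c k)))"

lemma hinge_convex:
  assumes "0 \<le> s" "s \<le> 1"
  shows "ennreal r * (ennreal s * x + ennreal (1 - s) * y) - ennreal c
    \<le> ennreal s * (ennreal r * x - ennreal c) + ennreal (1 - s) * (ennreal r * y - ennreal c)"
proof -
  have le: "z \<le> (z - ennreal c) + ennreal c" for z
    by (cases "ennreal c \<le> z") (auto simp: diff_add_self_ennreal not_le intro: less_imp_le)
  have c: "ennreal s * ennreal c + ennreal (1 - s) * ennreal c = ennreal c"
    using assms by (simp flip: distrib_right ennreal_plus)
  have "ennreal r * (ennreal s * x + ennreal (1 - s) * y)
      = ennreal s * (ennreal r * x) + ennreal (1 - s) * (ennreal r * y)"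
    by (simp add: distrib_left mult_ac)
  also have "\<dots> \<le> ennreal s * ((ennreal r * x - ennreal c) + ennreal c)
      + ennreal (1 - s) * ((ennreal r * y - ennreal c) + ennreal c)"
    by (intro add_mono mult_left_mono le) auto
  also have "\<dots> = (ennreal s * (ennreal r * x - ennreal c) + ennreal (1 - s) * (ennreal r * y - ennreal c))
      + (ennreal s * ennreal c + ennreal (1 - s) * ennreal c)"
    by (simp add: distrib_left add_ac)
  finally show ?thesis
    unfolding ennreal_minus_le_iff c by (simp add: add.commute)
qed

lemma hinge_sum_mono: "x \<le> y \<Longrightarrow> hinge_sum r c x \<le> hinge_sum r c y"
  unfolding hinge_sum_def by (intro suminf_le mult_left_mono ennreal_minus_mono) auto

text \<open>The partial sums are continuous and increase to the nondecreasing sum, which is therefore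
  left-continuous, even where it jumps to \<open>\<infinity>\<close>.\<close>

lemma hinge_sum_tendsto_left: "(hinge_sum r c \<longlongrightarrow> hinge_sum r c t) (at_left t)"
proof (rule order_tendstoI)
  fix a assume "hinge_sum r c t < a"
  then have "hinge_sum r c y < a" if "y < t" for y
    using that by (meson hinge_sum_mono le_less_trans less_imp_le)
  then show "\<forall>\<^sub>F x in at_left t. hinge_sum r c x < a"
    by (auto simp: eventually_at_filter)
next
  fix a assume a: "a < hinge_sum r c t"
  let ?g = "\<lambda>k x. ennreal ((1/2) ^ Suc k) * (ennreal (r k) * x - ennreal (c k))"
  have part: "(\<Sum>k<n. ?g k x) \<le> hinge_sum r c x" for n x
    unfolding hinge_sum_def by (rule sum_le_suminf) auto
  have "hinge_sum r c t = (SUP n. \<Sum>k<n. ?g k t)"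
    unfolding hinge_sum_def by (rule suminf_eq_SUP)
  then obtain n where n: "a < (\<Sum>k<n. ?g k t)" using a by (auto simp: less_SUP_iff)
  have "((\<lambda>x. \<Sum>k<n. ?g k x) \<longlongrightarrow> (\<Sum>k<n. ?g k t)) (at_left t)"
    by (intro tendsto_sum ennreal_tendsto_cmult tendsto_diff_ennreal_general tendsto_const tendsto_ident_at) auto
  then have "\<forall>\<^sub>F x in at_left t. a < (\<Sum>k<n. ?g k x)" using n by (rule order_tendstoD)
  then show "\<forall>\<^sub>F x in at_left t. a < hinge_sum r c x"
    by eventually_elim (rule less_le_trans[OF _ part])
qed

lemma young_function_hinge_sum:
  assumes "\<exists>t>0. hinge_sum r c t \<noteq> 0" "\<exists>t>0. hinge_sum r c t \<noteq> \<infinity>"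
  shows "young_function (hinge_sum r c)"
  unfolding young_function_def
proof (intro conjI allI ballI assms hinge_sum_tendsto_left)
  fix x y and s :: real assume "s \<in> {0..1}"
  then have s: "0 \<le> s" "s \<le> 1" by auto
  let ?g = "\<lambda>k x. ennreal ((1/2) ^ Suc k) * (ennreal (r k) * x - ennreal (c k))"
  have "hinge_sum r c (ennreal s * x + ennreal (1 - s) * y)
      \<le> (\<Sum>k. ennreal s * ?g k x + ennreal (1 - s) * ?g k y)"
    unfolding hinge_sum_def
  proof (rule suminf_le)
    fix k
    have "?g k (ennreal s * x + ennreal (1 - s) * y) \<le> ennreal ((1/2) ^ Suc k) *
        (ennreal s * (ennreal (r k) * x - ennreal (c k)) + ennreal (1 - s) * (ennreal (r k) * y - ennreal (c k)))"
      by (intro mult_left_mono hinge_convex s) simp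
    also have "\<dots> = ennreal s * ?g k x + ennreal (1 - s) * ?g k y"
      by (simp add: distrib_left mult_ac)
    finally show "?g k (ennreal s * x + ennreal (1 - s) * y) \<le> ennreal s * ?g k x + ennreal (1 - s) * ?g k y" .
  qed auto
  also have "\<dots> = (\<Sum>k. ennreal s * ?g k x) + (\<Sum>k. ennreal (1 - s) * ?g k y)"
    by (rule suminf_add[symmetric]) auto
  also have "\<dots> = ennreal s * hinge_sum r c x + ennreal (1 - s) * hinge_sum r c y"
    unfolding hinge_sum_def by (simp only: ennreal_suminf_cmult)
  finally show "hinge_sum r c (ennreal s * x + ennreal (1 - s) * y)
    \<le> ennreal s * hinge_sum r c x + ennreal (1 - s) * hinge_sum r c y" .
next
  show "hinge_sum r c 0 = 0" by (simp add: hinge_sum_def)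
qed

text \<open>The slope integral is linear in \<open>D\<close>, so hinges admissible with \<open>K = 1\<close> can be averaged.\<close>

lemma hinge_sum_slope_integral_bound:
  assumes r: "\<And>k. 0 < r k" and b: "\<And>k. 0 < b k"
    and avg: "\<And>k. exp_average_complementary A (ennreal (r k)) \<le> ennreal (b k)"
  shows "slope_integral_bound A (hinge_sum r (\<lambda>k. exp 1 * b k)) 1"
  unfolding slope_integral_bound_def
proof (intro allI impI)
  fix t :: real assume t: "0 < t"
  let ?h = "\<lambda>k \<tau>. ennreal (r k * \<tau> - exp 1 * b k) / ennreal (\<tau>\<^sup>2) * indicator {0<..<t} \<tau>"
  have "(\<integral>\<^sup>+\<tau>\<in>{0<..<t}. hinge_sum r (\<lambda>k. exp 1 * b k) (ennreal \<tau>) / ennreal (\<tau>\<^sup>2) \<partial>lborel)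
      = (\<integral>\<^sup>+\<tau>. (\<Sum>k. ennreal ((1/2) ^ Suc k) * ?h k \<tau>) \<partial>lborel)"
  proof (rule nn_integral_cong)
    fix \<tau> :: real
    show "hinge_sum r (\<lambda>k. exp 1 * b k) (ennreal \<tau>) / ennreal (\<tau>\<^sup>2) * indicator {0<..<t} \<tau>
        = (\<Sum>k. ennreal ((1/2) ^ Suc k) * ?h k \<tau>)"
    proof (cases "0 < \<tau> \<and> \<tau> < t")
      case True
      have "ennreal (r k) * ennreal \<tau> - ennreal (exp 1 * b k) = ennreal (r k * \<tau> - exp 1 * b k)" for k
        using True r[of k] b[of k] by (simp add: ennreal_minus flip: ennreal_mult)
      then have "hinge_sum r (\<lambda>k. exp 1 * b k) (ennreal \<tau>) = (\<Sum>k. ennreal ((1/2) ^ Suc k) * ennreal (r k * \<tau> - exp 1 * b k))"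
        by (simp only: hinge_sum_def)
      then show ?thesis using True by (simp add: ennreal_times_divide flip: ennreal_suminf_divide)
    qed auto
  qed
  also have "\<dots> = (\<Sum>k. \<integral>\<^sup>+\<tau>. ennreal ((1/2) ^ Suc k) * ?h k \<tau> \<partial>lborel)"
    by (rule nn_integral_suminf) measurable
  also have "\<dots> = (\<Sum>k. ennreal ((1/2) ^ Suc k) * (\<integral>\<^sup>+\<tau>. ?h k \<tau> \<partial>lborel))"
    by (intro suminf_cong nn_integral_cmult) measurable
  also have "\<dots> \<le> (\<Sum>k. ennreal ((1/2) ^ Suc k) * (A (ennreal t) / ennreal t))"
    by (intro suminf_le mult_left_mono hinge_slope_integral_le avg r b t) auto
  also have "\<dots> = A (ennreal t) / ennreal t"
    by (simp only: ennreal_suminf_multc suminf_half_powers mult_1)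
  finally show "(\<integral>\<^sup>+\<tau>\<in>{0<..<t}. hinge_sum r (\<lambda>k. exp 1 * b k) (ennreal \<tau>) / ennreal (\<tau>\<^sup>2) \<partial>lborel)
    \<le> A (ennreal (1 * t)) / ennreal t" by simp
qed

text \<open>Admissibility keeps \<open>D\<close> from being infinite on \<open>(0, \<infinity>)\<close>, because \<open>A\<close> is finite somewhere.\<close>

lemma slope_integral_bound_finite_point:
  assumes A: "young_function A" and IC: "slope_integral_bound A D 1"
  shows "\<exists>t>0. D t \<noteq> \<infinity>"
proof (rule ccontr)
  assume neg: "\<not> (\<exists>t>0. D t \<noteq> \<infinity>)"
  obtain t where t: "0 < t" "A (ennreal t) < \<infinity>" using young_function_finite_point[OF A] .
  have "(\<integral>\<^sup>+\<tau>\<in>{0<..<t}. D (ennreal \<tau>) / ennreal (\<tau>\<^sup>2) \<partial>lborel)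
      = (\<integral>\<^sup>+\<tau>. \<infinity> * indicator {0<..<t} \<tau> \<partial>lborel)"
  proof (rule nn_integral_cong)
    fix \<tau> :: real
    show "D (ennreal \<tau>) / ennreal (\<tau>\<^sup>2) * indicator {0<..<t} \<tau> = \<infinity> * indicator {0<..<t} \<tau>"
    proof (cases "0 < \<tau> \<and> \<tau> < t")
      case True
      then have "0 < ennreal \<tau>" by simp
      then have "D (ennreal \<tau>) = \<infinity>" using neg by blast
      then show ?thesis using True by (simp add: ennreal_top_divide)
    qed auto
  qed
  also have "\<dots> = \<infinity>" using t by (subst nn_integral_cmult_indicator) (auto simp: ennreal_top_mult)
  finally have "A (ennreal t) / ennreal t = \<infinity>"
    using IC t by (auto simp: slope_integral_bound_def top_unique)
  then show False using t by (auto simp: ennreal_divide_eq_top_iff)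
qed

text \<open>If \<open>BA\<close> is not dominated by \<open>B\<close>, there are points \<open>t k\<close> and lines \<open>r k * \<sigma> - b k\<close> below \<open>BA\<close> that
  exceed \<open>B(C k * t k)\<close> at \<open>t k\<close>.  The hinges with intercepts \<open>exp 1 * b k\<close> are admissible with
  \<open>K = 1\<close>, and so is their weighted sum \<open>D\<close>.  Minimality puts \<open>L\<^sup>B\<close> inside \<open>L\<^sup>D\<close>, which contradicts
  the size of \<open>D\<close> along the points \<open>\<tau> k\<close>.\<close>

lemma smallest_orlicz_target_dominates:
  assumes A: "young_function A"
    and B: "smallest_orlicz_target TYPE('n::finite) A B"
    and BA: "young_function BA" "\<And>t. complementary BA t = exp_average_complementary A t"
  shows "\<exists>C>0. \<forall>x. BA x \<le> B (ennreal C * x)"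
proof (rule ccontr)
  assume neg: "\<not> ?thesis"
  have yB: "young_function B" using B by (simp add: smallest_orlicz_target_def)
  \<comment> \<open>The factor \<open>4\<^sup>k\<close> contradicts domination, \<open>2\<^bsup>Suc k\<^esup>\<close> compensates the weight in the sum, and \<open>exp 1\<close> the enlarged intercept.\<close>
  define C :: "nat \<Rightarrow> real" where "C k = 4 ^ k * (2 ^ Suc k * exp 1)" for k
  have C: "0 < C k" for k by (simp add: C_def)
  have "\<exists>t r b. 0 < t \<and> 0 < r \<and> 0 < b \<and> B (ennreal (C k * t)) < ennreal (r * t - b) \<and>
      (\<forall>\<sigma>\<ge>0. ennreal (r * \<sigma> - b) \<le> BA (ennreal \<sigma>))" for k
  proof -
    obtain x where x: "B (ennreal (C k) * x) < BA x" using neg C[of k] by (auto simp: not_le)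
    have "x \<noteq> \<infinity>"
    proof
      assume "x = \<infinity>"
      then show False using x C[of k] young_function_top[OF yB] by (simp add: ennreal_mult_top)
    qed
    then obtain t where t: "x = ennreal t" "0 \<le> t" by (cases x) auto
    have "t \<noteq> 0" using x t young_function_0[OF BA(1)] by auto
    then have t0: "0 < t" using t by simp
    obtain m where m: "B (ennreal (C k) * x) = ennreal m" "0 \<le> m"
      using x by (cases "B (ennreal (C k) * x)") auto
    have "ennreal m < BA (ennreal t)" using x m t by simp
    then obtain r b where rb: "0 < r" "0 < b" "m < r * t - b"
      "\<And>\<sigma>. 0 \<le> \<sigma> \<Longrightarrow> ennreal (r * \<sigma> - b) \<le> BA (ennreal \<sigma>)"
      using young_function_supporting_line[OF BA(1) t0 m(2)] by metis
    have "ennreal (C k * t) = ennreal (C k) * x" using C[of k] t by (simp add: ennreal_mult)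
    then have "B (ennreal (C k * t)) < ennreal (r * t - b)" using m rb by (simp add: ennreal_less_iff)
    then show ?thesis using t0 rb by blast
  qed
  then obtain t r b where t: "\<And>k. 0 < t k" and r: "\<And>k. 0 < r k" and b: "\<And>k. 0 < b k"
    and less: "\<And>k. B (ennreal (C k * t k)) < ennreal (r k * t k - b k)"
    and line: "\<And>k \<sigma>. 0 \<le> \<sigma> \<Longrightarrow> ennreal (r k * \<sigma> - b k) \<le> BA (ennreal \<sigma>)"
    by metis
  have avg: "exp_average_complementary A (ennreal (r k)) \<le> ennreal (b k)" for k
    unfolding BA(2)[symmetric]
  proof (rule complementary_leI)
    fix u :: real assume u: "0 < u"
    have "ennreal u * ennreal (r k) = ennreal (u * r k)" using u r[of k] by (simp add: ennreal_mult)
    also have "\<dots> \<le> ennreal (r k * u - b k) + ennreal (b k)"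
      using b[of k] by (auto simp: ennreal_plus_if mult.commute intro!: ennreal_leI)
    also have "\<dots> \<le> BA (ennreal u) + ennreal (b k)" using line[of u k] u by (intro add_right_mono) simp
    finally show "ennreal u * ennreal (r k) \<le> BA (ennreal u) + ennreal (b k)" .
  qed simp
  define D where "D = hinge_sum r (\<lambda>k. exp 1 * b k)"
  have IC: "slope_integral_bound A D 1"
    unfolding D_def by (rule hinge_sum_slope_integral_bound[OF r b avg])
  define \<tau> where "\<tau> k = 2 ^ Suc k * (exp 1 * t k)" for k
  have \<tau>: "0 < \<tau> k" for k using t[of k] by (simp add: \<tau>_def)
  have C\<tau>: "C k * t k = 4 ^ k * \<tau> k" for k by (simp add: C_def \<tau>_def)
  have big: "B (ennreal (4 ^ k * \<tau> k)) < D (ennreal (\<tau> k))" for k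
  proof -
    have "B (ennreal (4 ^ k * \<tau> k)) < ennreal (r k * t k - b k)" using less[of k] C\<tau> by simp
    also have "\<dots> \<le> ennreal ((1/2) ^ Suc k * (r k * \<tau> k - exp 1 * b k))"
    proof (rule ennreal_leI)
      have p: "0 < r k * t k - b k" using less[of k] by (metis ennreal_less_zero_iff le_less_trans zero_le)
      have e: "1 \<le> exp (1::real)" by simp
      have "r k * t k - b k = 1 * (r k * t k - b k)" by simp
      also have "\<dots> \<le> exp 1 * (r k * t k - b k)" using p e by (intro mult_right_mono) auto
      also have "\<dots> = exp 1 * (r k * t k) - exp 1 * b k * 1" by (simp add: right_diff_distrib)
      also have "\<dots> \<le> exp 1 * (r k * t k) - exp 1 * b k * (1/2) ^ Suc k"
      proof (rule diff_left_mono, rule mult_left_mono)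
        show "(1/2) ^ Suc k \<le> (1::real)" by (rule power_le_one) auto
        show "0 \<le> exp 1 * b k" using b[of k] by simp
      qed
      also have "\<dots> = (1/2) ^ Suc k * (r k * \<tau> k - exp 1 * b k)"
      proof -
        have "(1/2 :: real) ^ Suc k * 2 ^ Suc k = 1" by (simp flip: power_mult_distrib)
        then have "(1/2) ^ Suc k * (r k * \<tau> k) = exp 1 * (r k * t k)"
          unfolding \<tau>_def by (metis mult.assoc mult.left_commute mult_1)
        then show ?thesis unfolding right_diff_distrib by (simp only: mult_ac)
      qed
      finally show "r k * t k - b k \<le> (1/2) ^ Suc k * (r k * \<tau> k - exp 1 * b k)" .
    qed
    also have "\<dots> = ennreal ((1/2) ^ Suc k) * (ennreal (r k) * ennreal (\<tau> k) - ennreal (exp 1 * b k))"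
    proof -
      have "ennreal (r k) * ennreal (\<tau> k) = ennreal (r k * \<tau> k)"
        using r[of k] \<tau>[of k] by (intro ennreal_mult[symmetric]) auto
      moreover have "\<dots> - ennreal (exp 1 * b k) = ennreal (r k * \<tau> k - exp 1 * b k)"
        using b[of k] by (intro ennreal_minus) auto
      moreover have "ennreal ((1/2) ^ Suc k * (r k * \<tau> k - exp 1 * b k))
          = ennreal ((1/2) ^ Suc k) * ennreal (r k * \<tau> k - exp 1 * b k)"
        by (rule ennreal_mult') simp
      ultimately show ?thesis by (simp only:)
    qed
    also have "\<dots> \<le> D (ennreal (\<tau> k))"
      unfolding D_def hinge_sum_def
      using sum_le_suminf[of "\<lambda>k'. ennreal ((1/2) ^ Suc k') * (ennreal (r k') * ennreal (\<tau> k) - ennreal (exp 1 * b k'))" "{k}"]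
      by simp
    finally show ?thesis .
  qed
  have yD: "young_function D"
    unfolding D_def
  proof (rule young_function_hinge_sum)
    have "hinge_sum r (\<lambda>k. exp 1 * b k) (ennreal (\<tau> 0)) \<noteq> 0"
      using big[of 0] unfolding D_def by auto
    then show "\<exists>t>0. hinge_sum r (\<lambda>k. exp 1 * b k) t \<noteq> 0" using \<tau>[of 0] by (intro exI[of _ "ennreal (\<tau> 0)"]) simp
    show "\<exists>t>0. hinge_sum r (\<lambda>k. exp 1 * b k) t \<noteq> \<infinity>"
      using slope_integral_bound_finite_point[OF A IC] by (simp add: D_def)
  qed
  have "maximal_bounded TYPE('n) A D"
    by (rule maximal_bounded_of_slope_integral_bound[OF A yD _ IC]) simp
  then have "(orlicz_space B :: (real ^ 'n \<Rightarrow> real) set) \<subseteq> orlicz_space D"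
    using B yD by (simp add: smallest_orlicz_target_def)
  then obtain k :: nat where "\<forall>t>0. D (ennreal t) \<le> B (ennreal (4 ^ k * t))"
    using orlicz_space_subset_imp_dominated[OF yB yD] by blast
  then show False using big[of k] \<tau>[of k] by (meson not_le)
qed

section \<open>The equivalence\<close>

theorem theorem5p2:
  fixes A :: "ennreal \<Rightarrow> ennreal"
  assumes "young_function A"
  shows "((\<exists>t0::real. 0 < t0 \<and> exp_average_complementary A (ennreal t0) < \<infinity>) \<longrightarrow>
           (\<forall>BA. young_function BA \<longrightarrow>
              (\<forall>t. complementary BA t = exp_average_complementary A t) \<longrightarrow>
              (maximal_bounded TYPE('n::finite) A BA \<longleftrightarrow> smallest_orlicz_target TYPE('n) A BA) \<and>
              (smallest_orlicz_target TYPE('n) A BA \<longleftrightarrow>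
                 (\<exists>B. smallest_orlicz_target TYPE('n) A B)) \<and>
              ((\<exists>B. smallest_orlicz_target TYPE('n) A B) \<longleftrightarrow>
                 (\<exists>K::real. 0 < K \<and> (\<forall>t::real. 0 < t \<longrightarrow>
                    (\<integral>\<^sup>+\<tau>\<in>{0<..<t}. BA (ennreal \<tau>) / ennreal (\<tau>\<^sup>2) \<partial>lborel)
                      \<le> A (ennreal (K * t)) / ennreal t)))))
         \<and>
         (\<not> (\<exists>t0::real. 0 < t0 \<and> exp_average_complementary A (ennreal t0) < \<infinity>) \<longrightarrow>
           \<not> (\<exists>B. young_function B \<and> maximal_bounded TYPE('n) A B))"
proof (intro conjI[of "_ \<longrightarrow> _" "_ \<longrightarrow> _"] impI allI)
  fix BA assume BA: "young_function BA" "\<forall>t. complementary BA t = exp_average_complementary A t"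
  have ii: "smallest_orlicz_target TYPE('n) A BA" if "maximal_bounded TYPE('n) A BA"
    using that BA(2) by (intro smallest_of_maximal_bounded[OF assms BA(1)]) auto
  have i: "maximal_bounded TYPE('n) A BA" if B: "smallest_orlicz_target TYPE('n) A B" for B
  proof -
    obtain C where C: "0 < C" "\<And>x. BA x \<le> B (ennreal C * x)"
      using smallest_orlicz_target_dominates[OF assms B BA(1)] BA(2) by auto
    show ?thesis
      by (rule maximal_bounded_of_dominated[where B = B and C = C])
        (use B C in \<open>auto simp: smallest_orlicz_target_def\<close>)
  qed
  have iv: "maximal_bounded TYPE('n) A BA \<longleftrightarrow> (\<exists>K>0. slope_integral_bound A BA K)"
    using maximal_bounded_of_slope_integral_bound[OF assms BA(1)]
      slope_integral_bound_of_maximal_bounded[OF assms BA(1)] by metis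
  show "(maximal_bounded TYPE('n) A BA \<longleftrightarrow> smallest_orlicz_target TYPE('n) A BA) \<and>
      (smallest_orlicz_target TYPE('n) A BA \<longleftrightarrow> (\<exists>B. smallest_orlicz_target TYPE('n) A B)) \<and>
      ((\<exists>B. smallest_orlicz_target TYPE('n) A B) \<longleftrightarrow>
         (\<exists>K::real. 0 < K \<and> (\<forall>t::real. 0 < t \<longrightarrow>
            (\<integral>\<^sup>+\<tau>\<in>{0<..<t}. BA (ennreal \<tau>) / ennreal (\<tau>\<^sup>2) \<partial>lborel) \<le> A (ennreal (K * t)) / ennreal t)))"
    using i ii iv unfolding slope_integral_bound_def by blast
next
  assume "\<not> (\<exists>t0::real. 0 < t0 \<and> exp_average_complementary A (ennreal t0) < \<infinity>)"
  then show "\<not> (\<exists>B. young_function B \<and> maximal_bounded TYPE('n) A B)"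
    using exp_average_finite_of_maximal_bounded[OF assms] by blast
qed

end
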